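(* Let $p$ be a prime, $n \geq 0$ an integer, and $P$ a nontrivial finite $p$-group of nilpotence class at most $n(p-1)+1$. Let $\mathcal{F}$ be a saturated fusion system on $P$ with $O_p(\mathcal{F}) = 1$. Then $Z(P)$ has exponent at most $p^n$.
   Context: A category on $P$ has as objects the subgroups of $P$, with $\mathrm{Hom}_{\mathcal F}(Q,R)$ a set of injective group homomorphisms $Q\to R$ such that every morphism is an $\mathcal F$-isomorphism followed by an inclusion. A saturated fusion system on $P$ is such a category containing all homomorphisms induced by conjugation by elements of $P$, in which $\mathrm{Aut}_P(P)$ is a Sylow $p$-subgroup of $\mathrm{Aut}_{\mathcal F}(P)$, and such that for every $\mathcal F$-isomorphism $\varphi: Q\to Q'$ with $Q'$ fully $\mathcal F$-normalized (i.e. $|N_P(Q')|\ge |N_P(Q'')|$ for all $Q''$ $\mathcal F$-isomorphic to $Q'$), $\varphi$ extends to an $\mathcal F$-morphism $N_\varphi\to P$, where $N_\varphi=\{x\in N_P(Q): \exists y\in N_P(\varphi(Q))\ \forall z\in Q,\ \varphi(xzx^{-1})=y\varphi(z)y^{-1}\}$. For $W\le P$, the normalizer $N_{\mathcal F}(W)$ is the category on $N_P(W)$ whose morphisms $R_1\to R_2$ are those $\mathcal F$-morphisms $\varphi$ admitting an extension $\tilde\varphi: WR_1\to WR_2$ in $\mathcal F$ with $\tilde\varphi(W)=W$. $W$ is normal in $\mathcal F$ if $\mathcal F = N_{\mathcal F}(W)$, and $O_p(\mathcal F)$ is the largest subgroup of $P$ normal in $\mathcal F$. *)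

theory Defs
  imports "HOL-Algebra.Algebra"
begin

definition grp_center :: "('a, 'b) monoid_scheme \<Rightarrow> 'a set" where
  "grp_center P = {z \<in> carrier P. \<forall>x \<in> carrier P. z \<otimes>\<^bsub>P\<^esub> x = x \<otimes>\<^bsub>P\<^esub> z}"

definition grp_commutator_set :: "('a, 'b) monoid_scheme \<Rightarrow> 'a set \<Rightarrow> 'a set \<Rightarrow> 'a set" where
  "grp_commutator_set P A B =
     {a \<otimes>\<^bsub>P\<^esub> b \<otimes>\<^bsub>P\<^esub> inv\<^bsub>P\<^esub> a \<otimes>\<^bsub>P\<^esub> inv\<^bsub>P\<^esub> b | a b. a \<in> A \<and> b \<in> B}"

text \<open>Lower central series: gamma 0 = P (i.e. gamma_1 in the usual indexing),
  gamma (i+1) = [gamma i, P].\<close>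
fun lower_central :: "('a, 'b) monoid_scheme \<Rightarrow> nat \<Rightarrow> 'a set" where
  "lower_central P 0 = carrier P"
| "lower_central P (Suc i) = generate P (grp_commutator_set P (lower_central P i) (carrier P))"

definition nilpotent_class_le :: "('a, 'b) monoid_scheme \<Rightarrow> nat \<Rightarrow> bool" where
  "nilpotent_class_le P c \<longleftrightarrow> lower_central P c = {\<one>\<^bsub>P\<^esub>}"

definition normalizer_in :: "('a, 'b) monoid_scheme \<Rightarrow> 'a set \<Rightarrow> 'a set" where
  "normalizer_in P Q = {x \<in> carrier P. (\<lambda>z. x \<otimes>\<^bsub>P\<^esub> z \<otimes>\<^bsub>P\<^esub> inv\<^bsub>P\<^esub> x) ` Q = Q}"

definition conjmap :: "('a, 'b) monoid_scheme \<Rightarrow> 'a \<Rightarrow> 'a set \<Rightarrow> 'a \<Rightarrow> 'a" where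
  "conjmap P x Q = restrict (\<lambda>z. x \<otimes>\<^bsub>P\<^esub> z \<otimes>\<^bsub>P\<^esub> inv\<^bsub>P\<^esub> x) Q"

text \<open>A (fusion) category on P: Hom Q R is the set of morphisms Q \<rightarrow> R for subgroups Q, R
  of P; morphisms are represented as maps that are extensional on their domain.\<close>
definition fusion_category :: "('a, 'b) monoid_scheme \<Rightarrow> ('a set \<Rightarrow> 'a set \<Rightarrow> ('a \<Rightarrow> 'a) set) \<Rightarrow> bool" where
  "fusion_category P Hom \<longleftrightarrow>
     (\<forall>Q R. subgroup Q P \<longrightarrow> subgroup R P \<longrightarrow>
        (\<forall>\<phi> \<in> Hom Q R. \<phi> \<in> extensional Q \<and>
            \<phi> \<in> hom (P\<lparr>carrier := Q\<rparr>) (P\<lparr>carrier := R\<rparr>) \<and> inj_on \<phi> Q)) \<and>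
     (\<forall>Q. subgroup Q P \<longrightarrow> restrict id Q \<in> Hom Q Q) \<and>
     (\<forall>Q R S \<phi> \<psi>. subgroup Q P \<longrightarrow> subgroup R P \<longrightarrow> subgroup S P \<longrightarrow>
        \<phi> \<in> Hom Q R \<longrightarrow> \<psi> \<in> Hom R S \<longrightarrow> restrict (\<psi> \<circ> \<phi>) Q \<in> Hom Q S) \<and>
     \<comment> \<open>every morphism is an F-isomorphism followed by an inclusion\<close>
     (\<forall>Q R \<phi>. subgroup Q P \<longrightarrow> subgroup R P \<longrightarrow> \<phi> \<in> Hom Q R \<longrightarrow>
        \<phi> \<in> Hom Q (\<phi> ` Q) \<and> restrict (inv_into Q \<phi>) (\<phi> ` Q) \<in> Hom (\<phi> ` Q) Q \<and>
        (\<forall>S. subgroup S P \<longrightarrow> \<phi> ` Q \<subseteq> S \<longrightarrow> \<phi> \<in> Hom Q S))"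

text \<open>F-isomorphism Q \<rightarrow> Q' (bijective F-morphism; its inverse lies in F by the axioms).\<close>
definition fusion_iso where
  "fusion_iso Hom Q Q' \<phi> \<longleftrightarrow> \<phi> \<in> Hom Q Q' \<and> \<phi> ` Q = Q'"

definition fully_normalized where
  "fully_normalized P Hom Q' \<longleftrightarrow> subgroup Q' P \<and>
     (\<forall>Q''. subgroup Q'' P \<longrightarrow> (\<exists>\<phi>. fusion_iso Hom Q' Q'' \<phi>) \<longrightarrow>
        card (normalizer_in P Q'') \<le> card (normalizer_in P Q'))"

definition N_phi :: "('a, 'b) monoid_scheme \<Rightarrow> 'a set \<Rightarrow> ('a \<Rightarrow> 'a) \<Rightarrow> 'a set" where
  "N_phi P Q \<phi> = {x \<in> normalizer_in P Q. \<exists>y \<in> normalizer_in P (\<phi> ` Q).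
      \<forall>z \<in> Q. \<phi> (x \<otimes>\<^bsub>P\<^esub> z \<otimes>\<^bsub>P\<^esub> inv\<^bsub>P\<^esub> x) = y \<otimes>\<^bsub>P\<^esub> \<phi> z \<otimes>\<^bsub>P\<^esub> inv\<^bsub>P\<^esub> y}"

definition saturated_fusion_system :: "('a, 'b) monoid_scheme \<Rightarrow> ('a set \<Rightarrow> 'a set \<Rightarrow> ('a \<Rightarrow> 'a) set) \<Rightarrow> nat \<Rightarrow> bool" where
  "saturated_fusion_system P Hom p \<longleftrightarrow>
     fusion_category P Hom \<and>
     \<comment> \<open>contains all homomorphisms induced by conjugation in P\<close>
     (\<forall>Q R x. subgroup Q P \<longrightarrow> subgroup R P \<longrightarrow> x \<in> carrier P \<longrightarrow>
        (\<lambda>z. x \<otimes>\<^bsub>P\<^esub> z \<otimes>\<^bsub>P\<^esub> inv\<^bsub>P\<^esub> x) ` Q \<subseteq> R \<longrightarrow> conjmap P x Q \<in> Hom Q R) \<and>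
     \<comment> \<open>Aut_P(P) is a Sylow p-subgroup of Aut_F(P)\<close>
     (\<exists>k m. card ((\<lambda>x. conjmap P x (carrier P)) ` carrier P) = p ^ k \<and>
            card (Hom (carrier P) (carrier P)) = p ^ k * m \<and> \<not> p dvd m) \<and>
     \<comment> \<open>extension axiom\<close>
     (\<forall>Q Q' \<phi>. subgroup Q P \<longrightarrow> subgroup Q' P \<longrightarrow> fusion_iso Hom Q Q' \<phi> \<longrightarrow>
        fully_normalized P Hom Q' \<longrightarrow>
        (\<exists>\<psi> \<in> Hom (N_phi P Q \<phi>) (carrier P). \<forall>z \<in> Q. \<psi> z = \<phi> z))"

text \<open>W is normal in F, i.e. F = N_F(W): N_P(W) = P and every F-morphism R1 \<rightarrow> R2
  extends to an F-morphism WR1 \<rightarrow> WR2 mapping W onto W.\<close>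
definition normal_in_fusion where
  "normal_in_fusion P Hom W \<longleftrightarrow> subgroup W P \<and> normalizer_in P W = carrier P \<and>
     (\<forall>R1 R2 \<phi>. subgroup R1 P \<longrightarrow> subgroup R2 P \<longrightarrow> \<phi> \<in> Hom R1 R2 \<longrightarrow>
        (\<exists>\<psi> \<in> Hom (W <#>\<^bsub>P\<^esub> R1) (W <#>\<^bsub>P\<^esub> R2). (\<forall>z \<in> R1. \<psi> z = \<phi> z) \<and> \<psi> ` W = W))"

definition O_p_fusion where
  "O_p_fusion P Hom = (GREATEST W. normal_in_fusion P Hom W)"

end

theory Submission
  imports "HOL-Computational_Algebra.Polynomial" Defs
begin

text \<open>
  Let \<open>q = p ^ n\<close> and let \<open>W\<close> be the group of \<open>q\<close>-th powers of elements of \<open>Z(P)\<close>; it suffices to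
  show that \<open>W\<close> is normal in the fusion system. By a downward induction in the style of Alperin's
  fusion theorem one only has to look at \<open>A = Aut(Q)\<close> for \<open>Q < P\<close> fully normalized and centric.
  An element \<open>x\<close> of \<open>N(Q)\<close> with \<open>x ^ p\<close> in \<open>Q\<close> acts on the abelian group \<open>Z(Q)\<close> as \<open>1 + D\<close>, where
  \<open>(1 + D) ^ p = 1\<close> and, by the bound on the class, \<open>D ^ (n (p - 1) + 1) = 0\<close>. These relations force
  \<open>q D = 0\<close>, just as \<open>p\<close> is associated to \<open>(\<zeta> - 1) ^ (p - 1)\<close> in the \<open>p\<close>-th cyclotomic ring.
  So \<open>x\<close> centralizes the \<open>q\<close>-th powers in \<open>Z(Q)\<close>, i.e. it induces an element of the kernel \<open>K\<close> of
  the action of \<open>A\<close> on them. By a Frattini argument every element of \<open>A\<close> is, modulo \<open>K\<close>, one that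
  normalizes the image of \<open>N(Q)\<close> in \<open>K\<close> and hence extends to a subgroup larger than \<open>Q\<close>; and \<open>K\<close>
  fixes \<open>W\<close> pointwise.
\<close>

section \<open>Sylow theory\<close>

text \<open>Two obstacles shape the proof. Saturation, as defined here, makes Aut_P(Q) a Sylow
  p-subgroup of Aut_F(Q) only for Q = P, whereas the Frattini step uses this for every fully
  normalized Q; it is derived from the extension axiom in \<open>fully_normalized_sylow\<close>.
  Secondly, the automorphisms of Q that fix W pointwise need not form a normal subgroup, because W
  need not be invariant under Aut_F(Q). Hence K is defined by all q-th powers in Z(Q), a
  characteristic subgroup of Q. Centricity of Q puts Z(P) inside Z(Q), so that K does fix W; if Q is
  not centric, an element of C_P(Q) outside Q lies in N_phi for every automorphism phi of Q, and an
  extension to a larger subgroup is automatic. The exponent n (p - 1) + 1 is a weight: modulo the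
  relation (1 + D) ^ p = 1, each factor p in front of a power of D can be traded for p - 1 further
  factors D, at the cost of terms of higher weight. So p ^ n D is as deep as the iterated commutator
  that the class bound kills.\<close>

lemma (in group) inv_mult_cancel_left:
  "\<lbrakk>a \<in> carrier G; b \<in> carrier G\<rbrakk> \<Longrightarrow> inv a \<otimes> (a \<otimes> b) = b"
  "\<lbrakk>a \<in> carrier G; b \<in> carrier G\<rbrakk> \<Longrightarrow> a \<otimes> (inv a \<otimes> b) = b"
  by (simp_all add: m_assoc[symmetric])

text \<open>Orbits have p-power size and an orbit of size 1 is a fixed point, so every other orbit
  adds a multiple of \<open>p\<close>. The indicator function \<open>f\<close> of the non-fixed
  points lets \<open>disjoint_sum\<close> count orbit by orbit.\<close>

lemma (in group_action) card_fixed_points_mod: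
  assumes "Factorial_Ring.prime (p::nat)" and "order G = p ^ k" and "finite E"
  shows "p dvd card (E - {x \<in> E. \<forall>g \<in> carrier G. \<phi> g x = x})"
proof -
  define F where "F = {x \<in> E. \<forall>g \<in> carrier G. \<phi> g x = x}"
  define f :: "'c \<Rightarrow> nat" where "f = (\<lambda>x. if x \<in> F then 0 else 1)"
  have "p dvd (\<Sum>x\<in>orb. f x)" if orb: "orb \<in> orbits G E \<phi>" for orb
  proof -
    obtain x where x: "x \<in> E" "orb = orbit G \<phi> x" using orb by (auto simp: orbits_def)
    have xo: "x \<in> orb" using x orbit_refl by simp
    have sub: "orb \<subseteq> E" using x element_image by (auto simp: orbit_def)
    show ?thesis
    proof (cases "orb \<inter> F = {}")
      case False
      then obtain y where y: "y \<in> orb" "y \<in> F" by auto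
      have "x \<in> orbit G \<phi> y" using y x orbit_sym sub by auto
      then have "x = y" using y(2) by (auto simp: orbit_def F_def)
      then have "orb = {x}" using y(2) x xo by (auto simp: orbit_def F_def)
      then show ?thesis using y \<open>x = y\<close> by (simp add: f_def)
    next
      case True
      then have s: "(\<Sum>x\<in>orb. f x) = card orb"
        unfolding f_def by (subst sum.cong[of orb orb _ "\<lambda>_. 1"]) auto
      have "card orb dvd p ^ k"
        using orbit_stabilizer_theorem[OF x(1)] assms(2) x(2) by (metis dvd_triv_left)
      then obtain i where i: "card orb = p ^ i"
        using assms(1) divides_primepow_nat by blast
      have "i \<noteq> 0"
      proof
        assume "i = 0"
        then have "card orb = 1" using i by simp
        then have o: "orb = {x}" using xo by (metis card_1_singletonE singletonD)
        have "\<phi> g x = x" if "g \<in> carrier G" for g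
          using that o x(2) by (auto simp: orbit_def)
        then have "x \<in> F" using x by (auto simp: F_def)
        then show False using True xo by auto
      qed
      then show ?thesis using s i by simp
    qed
  qed
  then have "p dvd (\<Sum>orb\<in>orbits G E \<phi>. \<Sum>x\<in>orb. f x)" by (rule dvd_sum)
  also have "\<dots> = (\<Sum>x\<in>E. f x)" using disjoint_sum assms(3) by blast
  also have "\<dots> = (\<Sum>x\<in>E. (if x \<notin> F then 1 else 0))" unfolding f_def by (rule sum.cong) auto
  also have "\<dots> = card (E - F)" using assms(3) by (simp add: sum.If_cases set_diff_eq Int_def)
  finally show ?thesis by (simp add: F_def)
qed

text \<open>Right multiplication reverses products, so \<open>g\<close> acts through
  \<open>inv g\<close> to give a homomorphism into \<open>BijGroup\<close>.\<close>

lemma (in group) action_on_rcosets: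
  assumes S: "subgroup S G"
  shows "group_action G (rcosets S) (\<lambda>g. \<lambda>M \<in> rcosets S. M #> inv g)"
proof -
  define \<phi> where "\<phi> = (\<lambda>g. \<lambda>M \<in> rcosets S. M #> inv g)"
  have sub: "M \<subseteq> carrier G" if "M \<in> rcosets S" for M
    using that rcosets_part_G[OF S] by auto
  have cl: "M #> g \<in> rcosets S" if "M \<in> rcosets S" "g \<in> carrier G" for M g
    using that S by (auto simp: RCOSETS_def coset_mult_assoc subgroup.subset)
  have bij: "\<phi> g \<in> Bij (rcosets S)" if g: "g \<in> carrier G" for g
  proof -
    have "bij_betw (\<phi> g) (rcosets S) (rcosets S)"
      by (rule bij_betw_byWitness[where f' = "\<lambda>M. M #> g"])
        (auto simp: \<phi>_def cl g coset_mult_assoc sub)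
    then show ?thesis by (simp add: Bij_def \<phi>_def)
  qed
  have "\<phi> \<in> hom G (BijGroup (rcosets S))"
  proof (rule homI)
    fix x assume "x \<in> carrier G"
    then show "\<phi> x \<in> carrier (BijGroup (rcosets S))" using bij by (simp add: BijGroup_def)
  next
    fix x y assume xy: "x \<in> carrier G" "y \<in> carrier G"
    show "\<phi> (x \<otimes> y) = \<phi> x \<otimes>\<^bsub>BijGroup (rcosets S)\<^esub> \<phi> y"
      using xy bij by (auto simp: BijGroup_def compose_def \<phi>_def fun_eq_iff cl
          coset_mult_assoc sub inv_mult_group)
  qed
  then show ?thesis
    unfolding group_action_def \<phi>_def[symmetric]
    by (simp add: group_hom_def group_BijGroup group_hom_axioms_def is_group)
qed

lemma (in group) prime_dvd_card_nonfixed_rcosets: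
  assumes "Factorial_Ring.prime (p::nat)" and fin: "finite (carrier G)"
    and S: "subgroup S G" and U: "subgroup U G" and cU: "card U = p ^ k"
  shows "p dvd card (rcosets S - {M \<in> rcosets S. \<forall>u \<in> U. M #> u = M})"
proof -
  interpret act: group_action "G\<lparr>carrier := U\<rparr>" "rcosets S" "\<lambda>g. \<lambda>M \<in> rcosets S. M #> inv g"
    using group_action.induced_action[OF action_on_rcosets[OF S] U] .
  have f: "finite (rcosets S)"
    using fin rcosets_part_G[OF S] by (metis finite_UnionD)
  \<comment> \<open>\<open>U\<close> is closed under inverses, so the inverse in the action does not
    change the set of fixed cosets.\<close>
  have "(\<forall>u \<in> U. M #> inv u = M) \<longleftrightarrow> (\<forall>u \<in> U. M #> u = M)" for M
    using subgroup.m_inv_closed[OF U] subgroup.subset[OF U] by (metis inv_inv subsetD)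
  then have "{M \<in> rcosets S. \<forall>g\<in>carrier (G\<lparr>carrier := U\<rparr>).
      (\<lambda>M \<in> rcosets S. M #> inv g) M = M} = {M \<in> rcosets S. \<forall>u \<in> U. M #> u = M}" by auto
  with act.card_fixed_points_mod[OF assms(1) _ f, of k] show ?thesis
    by (simp add: order_def cU)
qed

text \<open>Cosets fixed by a subgroup \<open>U\<close> thus correspond to elements conjugating
  \<open>U\<close> into \<open>S\<close>; for \<open>U = S\<close> they correspond to the normalizer
  of \<open>S\<close>.\<close>

lemma (in group) rcoset_fixed_iff:
  assumes S: "subgroup S G" and g: "g \<in> carrier G" and u: "u \<in> carrier G"
  shows "(S #> g) #> u = S #> g \<longleftrightarrow> g \<otimes> u \<otimes> inv g \<in> S"
proof -
  have sub: "S \<subseteq> carrier G" using S by (rule subgroup.subset)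
  have "(S #> g) #> u = S #> g \<longleftrightarrow> S #> (g \<otimes> u) = S #> g"
    by (simp add: coset_mult_assoc sub g u)
  also have "\<dots> \<longleftrightarrow> g \<otimes> u \<otimes> inv g \<in> S"
    using g u S sub by (metis coset_join1 coset_join2 coset_mult_inv1 coset_mult_inv2 inv_closed
        m_closed is_group)
  finally show ?thesis .
qed

text \<open>There are \<open>m\<close> cosets of \<open>S\<close>, a number prime to
  \<open>p\<close>, while the cosets not fixed by \<open>U\<close> come in a multiple of
  \<open>p\<close>; so some coset is fixed.\<close>

lemma (in group) sylow_conjugation:
  assumes p: "Factorial_Ring.prime (p::nat)" and fin: "finite (carrier G)"
    and S: "subgroup S G" and U: "subgroup U G" and cU: "card U = p ^ k"
    and idx: "card (carrier G) = card S * m" "\<not> p dvd m"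
  shows "\<exists>g \<in> carrier G. \<forall>u \<in> U. g \<otimes> u \<otimes> inv g \<in> S"
proof -
  define F where "F = {M \<in> rcosets S. \<forall>u \<in> U. M #> u = M}"
  have Spos: "card S > 0" using S fin subgroup.finite_imp_card_positive by blast
  have "card (rcosets S) = m"
    using lagrange[OF S] idx(1) Spos by (simp add: order_def mult.commute)
  moreover have f: "finite (rcosets S)"
    using fin rcosets_part_G[OF S] by (metis finite_UnionD)
  ultimately have "F \<noteq> {}"
    using prime_dvd_card_nonfixed_rcosets[OF p fin S U cU] idx(2) unfolding F_def[symmetric] by auto
  then obtain g where g: "g \<in> carrier G" "\<forall>u \<in> U. (S #> g) #> u = S #> g"
    by (auto simp: F_def RCOSETS_def)
  then show ?thesis
    using rcoset_fixed_iff[OF S] subgroup.subset[OF U] by blast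
qed

section \<open>Normalizers and their growth\<close>

lemma (in group) normalizer_in_alt:
  assumes S: "S \<subseteq> carrier G" and fin: "finite (carrier G)"
  shows "normalizer_in G S = {g \<in> carrier G. \<forall>s \<in> S. g \<otimes> s \<otimes> inv g \<in> S}"
proof -
  have "(\<lambda>z. g \<otimes> z \<otimes> inv g) ` S = S" if g: "g \<in> carrier G" "\<forall>s \<in> S. g \<otimes> s \<otimes> inv g \<in> S" for g
  proof (rule card_subset_eq)
    show "finite S" using S fin finite_subset by blast
    have "inj_on (\<lambda>z. g \<otimes> z \<otimes> inv g) S"
      using S g by (auto simp: inj_on_def subset_iff)
    then show "card ((\<lambda>z. g \<otimes> z \<otimes> inv g) ` S) = card S" by (rule card_image)
  qed (use g in auto)
  then show ?thesis by (auto simp: normalizer_in_def)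
qed

lemma (in group) normalizer_in_subgroup:
  assumes S: "S \<subseteq> carrier G"
  shows "subgroup (normalizer_in G S) G"
proof (rule subgroupI)
  show "normalizer_in G S \<subseteq> carrier G" by (auto simp: normalizer_in_def)
  have "(\<lambda>z. \<one> \<otimes> z \<otimes> inv \<one>) ` S = S" using S by (auto simp: subset_iff image_iff)
  then have "\<one> \<in> normalizer_in G S" unfolding normalizer_in_def by blast
  then show "normalizer_in G S \<noteq> {}" by blast
next
  fix g assume "g \<in> normalizer_in G S"
  then have g: "g \<in> carrier G" and im: "(\<lambda>z. g \<otimes> z \<otimes> inv g) ` S = S" by (auto simp: normalizer_in_def)
  have "(\<lambda>z. inv g \<otimes> z \<otimes> inv (inv g)) ` S = (\<lambda>z. inv g \<otimes> z \<otimes> inv (inv g)) ` ((\<lambda>z. g \<otimes> z \<otimes> inv g) ` S)"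
    by (simp only: im)
  also have "\<dots> = (\<lambda>z. z) ` S"
    unfolding image_image
    by (rule image_cong[OF refl]) (use S g in \<open>simp add: m_assoc subset_iff inv_mult_cancel_left\<close>)
  also have "\<dots> = S" by simp
  finally show "inv g \<in> normalizer_in G S" using g by (simp add: normalizer_in_def)
next
  fix g h assume "g \<in> normalizer_in G S" "h \<in> normalizer_in G S"
  then have g: "g \<in> carrier G" "(\<lambda>z. g \<otimes> z \<otimes> inv g) ` S = S"
    and h: "h \<in> carrier G" "(\<lambda>z. h \<otimes> z \<otimes> inv h) ` S = S" by (auto simp: normalizer_in_def)
  have "(\<lambda>z. g \<otimes> h \<otimes> z \<otimes> inv (g \<otimes> h)) ` S = (\<lambda>z. g \<otimes> z \<otimes> inv g) ` ((\<lambda>z. h \<otimes> z \<otimes> inv h) ` S)"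
    unfolding image_image
    by (rule image_cong[OF refl]) (use S g(1) h(1) in \<open>simp add: m_assoc subset_iff inv_mult_group\<close>)
  then have "(\<lambda>z. g \<otimes> h \<otimes> z \<otimes> inv (g \<otimes> h)) ` S = S" by (simp only: g(2) h(2))
  then show "g \<otimes> h \<in> normalizer_in G S" using g(1) h(1) by (simp add: normalizer_in_def)
qed

lemma (in group) subset_normalizer_in:
  assumes S: "subgroup S G" and fin: "finite (carrier G)"
  shows "S \<subseteq> normalizer_in G S"
  using subgroup.subset[OF S] subgroup.m_closed[OF S] subgroup.m_inv_closed[OF S]
  by (auto simp: normalizer_in_alt[OF _ fin])

text \<open>\<open>S\<close> acts on its own cosets, and the fixed ones are exactly the cosets
  inside the normalizer. Hence the index of \<open>S\<close> in its normalizer is congruent to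
  \<open>m\<close> modulo \<open>p\<close>, so it is divisible by \<open>p\<close>.\<close>

lemma (in group) normalizer_in_grows:
  assumes p: "Factorial_Ring.prime (p::nat)" and fin: "finite (carrier G)"
    and S: "subgroup S G" and cS: "card S = p ^ k"
    and idx: "card (carrier G) = card S * m" "p dvd m"
  shows "\<exists>g \<in> normalizer_in G S - S. \<exists>j. g [^] (p ^ j) = \<one>"
proof -
  define F where "F = {M \<in> rcosets S. \<forall>u \<in> S. M #> u = M}"
  define N where "N = normalizer_in G S"
  have SG: "S \<subseteq> carrier G" using S by (rule subgroup.subset)
  have N: "subgroup N G" unfolding N_def by (rule normalizer_in_subgroup[OF SG])
  have SN: "S \<subseteq> N" unfolding N_def by (rule subset_normalizer_in[OF S fin])
  have Spos: "card S > 0" using S fin subgroup.finite_imp_card_positive by blast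
  have cr: "card (rcosets S) = m"
    using lagrange[OF S] idx(1) Spos by (simp add: order_def mult.commute)
  have f: "finite (rcosets S)"
    using fin rcosets_part_G[OF S] by (metis finite_UnionD)
  have FE: "F = (\<lambda>g. S #> g) ` N"
    using rcoset_fixed_iff[OF S] SG
    by (auto simp: F_def RCOSETS_def N_def normalizer_in_alt[OF SG fin] subset_iff)
  have "p dvd card (rcosets S) - card F"
    using prime_dvd_card_nonfixed_rcosets[OF p fin S S cS] unfolding F_def[symmetric]
    by (subst (asm) card_Diff_subset) (auto simp: F_def intro: finite_subset[OF _ f])
  moreover have le: "card F \<le> card (rcosets S)" by (rule card_mono[OF f]) (auto simp: F_def)
  ultimately have pF: "p dvd card F" using cr idx(2)
    by (metis dvd_diffD1)
  interpret GN: group "G\<lparr>carrier := N\<rparr>" using N subgroup_imp_group by blast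
  have SN': "subgroup S (G\<lparr>carrier := N\<rparr>)" using S N SN by (simp add: subgroup_incl)
  have "rcosets\<^bsub>G\<lparr>carrier := N\<rparr>\<^esub> S = F"
    unfolding FE by (auto simp: RCOSETS_def r_coset_def)
  then have cN: "card F * card S = order (G\<lparr>carrier := N\<rparr>)"
    using GN.lagrange[OF SN'] by simp
  then obtain c where c: "order (G\<lparr>carrier := N\<rparr>) = p ^ Suc k * c"
  proof -
    obtain d where "card F = p * d" using pF by (auto simp: dvd_def)
    then have "order (G\<lparr>carrier := N\<rparr>) = p ^ Suc k * d" using cS by (simp flip: cN)
    then show ?thesis using that by blast
  qed
  have finN: "finite N" using N fin by (meson finite_subset subgroup.subset)
  \<comment> \<open>A subgroup of order p^(k+1) is too large to lie in \<open>S\<close>, and all its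
    elements have p-power order.\<close>
  obtain T where T: "subgroup T (G\<lparr>carrier := N\<rparr>)" "card T = p ^ Suc k"
    using sylow_thm[OF p GN.is_group c] finN by auto
  have "p > 1" using p by (rule prime_gt_1_nat)
  then have "card S < card T" using T cS by simp
  moreover have "finite S" using SG fin finite_subset by blast
  ultimately have "\<not> T \<subseteq> S" using card_mono by (metis leD)
  then obtain g where g: "g \<in> T" "g \<notin> S" by auto
  have TG: "subgroup T G" using incl_subgroup[OF N T(1)] .
  interpret GT: group "G\<lparr>carrier := T\<rparr>" using TG subgroup_imp_group by blast
  have "g [^]\<^bsub>G\<lparr>carrier := T\<rparr>\<^esub> order (G\<lparr>carrier := T\<rparr>) = \<one>"
    using GT.pow_order_eq_1[of g] g by simp
  then have "g [^] (p ^ Suc k) = \<one>"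
    using T(2) by (simp add: order_def nat_pow_consistent[symmetric])
  moreover have "g \<in> N" using g T subgroup.subset[OF T(1)] by auto
  ultimately show ?thesis using g unfolding N_def by blast
qed

text \<open>In the sequence g, g^p, g^(p^2), ... of a p-element of the normalizer outside
  \<open>S\<close>, the last member before the first one in \<open>S\<close> is the element
  sought.\<close>

lemma (in group) normalizer_in_grows_p_group:
  assumes p: "Factorial_Ring.prime (p::nat)" and fin: "finite (carrier G)"
    and cG: "card (carrier G) = p ^ a"
    and S: "subgroup S G" and ne: "S \<noteq> carrier G"
  shows "\<exists>g \<in> normalizer_in G S - S. g [^] p \<in> S"
proof -
  have l: "card (rcosets S) * card S = p ^ a" using lagrange[OF S] cG by (simp add: order_def)
  obtain k where k: "card S = p ^ k"
    using l p divides_primepow_nat by (metis dvd_triv_right)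
  obtain i where i: "card (rcosets S) = p ^ i"
    using l p divides_primepow_nat by (metis dvd_triv_left)
  have "i \<noteq> 0"
  proof
    assume "i = 0"
    then have "card S = card (carrier G)" using l i cG by simp
    then show False using ne card_subset_eq[OF fin subgroup.subset[OF S]] by simp
  qed
  then have "p dvd card (rcosets S)" using i by simp
  moreover have "card (carrier G) = card S * card (rcosets S)" using l cG by (simp add: mult.commute)
  ultimately obtain g j where g: "g \<in> normalizer_in G S" "g \<notin> S" "g [^] (p ^ j) = \<one>"
    using normalizer_in_grows[OF p fin S k] by blast
  have gG: "g \<in> carrier G" using g by (simp add: normalizer_in_def)
  define l where "l = (LEAST l. g [^] (p ^ l) \<in> S)"
  have ex: "g [^] (p ^ j) \<in> S" using g S subgroup.one_closed by simp
  have lS: "g [^] (p ^ l) \<in> S" unfolding l_def by (rule LeastI[of "\<lambda>l. g [^] (p ^ l) \<in> S", OF ex])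
  have "l \<noteq> 0" using lS g gG by (cases "l = 0") auto
  then obtain l' where l': "l = Suc l'" using not0_implies_Suc by blast
  define h where "h = g [^] (p ^ l')"
  have "h \<notin> S" using not_less_Least[of l' "\<lambda>l. g [^] (p ^ l) \<in> S"] l'
    unfolding h_def l_def by auto
  moreover have "h [^] p \<in> S" using lS gG l' by (simp add: h_def nat_pow_pow mult.commute)
  moreover have "h \<in> normalizer_in G S"
    unfolding h_def using normalizer_in_subgroup[OF subgroup.subset[OF S]] g(1)
    by (metis subgroup_int_pow_closed int_pow_int)
  ultimately show ?thesis by auto
qed

lemma (in group) sylow_frattini:
  assumes p: "Factorial_Ring.prime (p::nat)" and fin: "finite (carrier G)"
    and S: "subgroup S G" and cS: "card S = p ^ k"
    and idx: "card (carrier G) = card S * m" "\<not> p dvd m"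
    and K: "K \<lhd> G" and c: "c \<in> carrier G"
  shows "\<exists>x \<in> K. \<forall>t \<in> S \<inter> K. (x \<otimes> c) \<otimes> t \<otimes> inv (x \<otimes> c) \<in> S"
proof -
  have Ks: "subgroup K G" using K by (rule normal_imp_subgroup)
  have SG: "S \<subseteq> carrier G" and KG: "K \<subseteq> carrier G" using S Ks subgroup.subset by auto
  have HG: "subgroup (S <#> K) G"
    using mult_norm_subgroup[OF K S] commut_normal[OF S K] by simp
  define H where "H = S <#> K"
  interpret GH: group "G\<lparr>carrier := H\<rparr>" using HG subgroup_imp_group unfolding H_def by blast
  have SH: "S \<subseteq> H" 
    unfolding H_def set_mult_def using SG subgroup.one_closed[OF Ks] by (force simp: subset_iff)
  have KH: "K \<subseteq> H" 
    unfolding H_def set_mult_def using KG subgroup.one_closed[OF S] by (force simp: subset_iff)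
  have SH': "subgroup S (G\<lparr>carrier := H\<rparr>)" using S HG SH unfolding H_def by (simp add: subgroup_incl)
  define U where "U = (\<lambda>t. c \<otimes> t \<otimes> inv c) ` (S \<inter> K)"
  have T: "subgroup (S \<inter> K) G" using S Ks by (rule subgroups_Inter_pair)
  have UK: "U \<subseteq> K" unfolding U_def using K c by (auto simp: normal_inv_iff)
  have UG: "subgroup U G"
  proof (rule subgroupI)
    show "U \<subseteq> carrier G" using UK KG by auto
    show "U \<noteq> {}" using subgroup.one_closed[OF T] by (auto simp: U_def)
  next
    fix a assume "a \<in> U"
    then obtain t where t: "t \<in> S \<inter> K" "a = c \<otimes> t \<otimes> inv c" by (auto simp: U_def)
    then have "inv a = c \<otimes> inv t \<otimes> inv c" using c SG by (auto simp: inv_mult_group m_assoc)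
    then show "inv a \<in> U" using subgroup.m_inv_closed[OF T t(1)] by (auto simp: U_def)
  next
    fix a b assume "a \<in> U" "b \<in> U"
    then obtain t s where t: "t \<in> S \<inter> K" "a = c \<otimes> t \<otimes> inv c" and s: "s \<in> S \<inter> K" "b = c \<otimes> s \<otimes> inv c"
      by (auto simp: U_def)
    have tc: "t \<in> carrier G" "s \<in> carrier G" using t s SG by auto
    then have "a \<otimes> b = c \<otimes> (t \<otimes> s) \<otimes> inv c" using c t s by (simp add: m_assoc inv_mult_cancel_left)
    then show "a \<otimes> b \<in> U" using subgroup.m_closed[OF T t(1) s(1)] by (auto simp: U_def)
  qed
  have "subgroup U (G\<lparr>carrier := H\<rparr>)" using UG HG UK KH unfolding H_def by (simp add: subgroup_incl)
  moreover
  have "inj_on (\<lambda>t. c \<otimes> t \<otimes> inv c) (S \<inter> K)" using SG c by (auto simp: inj_on_def subset_iff)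
  then have cU: "card U = card (S \<inter> K)" unfolding U_def by (rule card_image)
  have "subgroup (S \<inter> K) (G\<lparr>carrier := S\<rparr>)" using T S by (simp add: subgroup_incl)
  then have "card (S \<inter> K) dvd card S"
    using group.lagrange[OF subgroup_imp_group[OF S], of "S \<inter> K"]
    by (simp add: order_def) (metis dvd_triv_right)
  then obtain i where "card (S \<inter> K) = p ^ i" using cS p divides_primepow_nat by metis
  moreover have "card (carrier (G\<lparr>carrier := H\<rparr>)) = card S * card (rcosets\<^bsub>G\<lparr>carrier := H\<rparr>\<^esub> S)"
    using GH.lagrange[OF SH'] by (simp add: order_def mult.commute)
  moreover have "\<not> p dvd card (rcosets\<^bsub>G\<lparr>carrier := H\<rparr>\<^esub> S)"
  proof
    assume a: "p dvd card (rcosets\<^bsub>G\<lparr>carrier := H\<rparr>\<^esub> S)"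
    have "card H dvd card (carrier G)"
      using lagrange[of H] HG unfolding H_def by (metis dvd_triv_right order_def)
    then have "card S * card (rcosets\<^bsub>G\<lparr>carrier := H\<rparr>\<^esub> S) dvd card S * m"
      using GH.lagrange[OF SH'] idx(1) by (simp add: order_def mult.commute)
    moreover have "card S > 0" using S fin subgroup.finite_imp_card_positive by blast
    ultimately show False using a idx(2) by (auto intro: dvd_trans)
  qed
  moreover have "finite (carrier (G\<lparr>carrier := H\<rparr>))"
    using subgroup.subset[OF HG] fin unfolding H_def by (simp add: finite_subset)
  ultimately obtain g where g: "g \<in> H" "\<forall>u \<in> U. g \<otimes> u \<otimes> inv\<^bsub>G\<lparr>carrier := H\<rparr>\<^esub> g \<in> S"
    using GH.sylow_conjugation[OF p _ SH', of U i] cU by auto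
  obtain s x where sx: "s \<in> S" "x \<in> K" "g = s \<otimes> x" using g(1) by (auto simp: H_def set_mult_def)
  have sxG: "s \<in> carrier G" "x \<in> carrier G" using sx SG KG by auto
  show ?thesis
  proof (intro bexI ballI)
    fix t assume t: "t \<in> S \<inter> K"
    then have tG: "t \<in> carrier G" using SG by auto
    have "g \<otimes> (c \<otimes> t \<otimes> inv c) \<otimes> inv g \<in> S"
      using g t HG by (auto simp: U_def H_def m_inv_consistent)
    then have "inv s \<otimes> (g \<otimes> (c \<otimes> t \<otimes> inv c) \<otimes> inv g) \<otimes> s \<in> S"
      using sx S by (simp add: subgroup.m_closed subgroup.m_inv_closed)
    also have "inv s \<otimes> (g \<otimes> (c \<otimes> t \<otimes> inv c) \<otimes> inv g) \<otimes> s = (x \<otimes> c) \<otimes> t \<otimes> inv (x \<otimes> c)"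
      using sxG c tG unfolding sx(3) by (simp add: inv_mult_group m_assoc inv_mult_cancel_left)
    finally show "(x \<otimes> c) \<otimes> t \<otimes> inv (x \<otimes> c) \<in> S" .
  qed (rule sx(2))
qed

section \<open>Unipotent automorphisms of prime order\<close>

text \<open>The coefficients strictly between the ends are multiples of \<open>p\<close>;
  \<open>g\<close> collects the terms of degree at least 2 among them. The linear term stays apart
  because it is the one that is solved for later.\<close>

lemma binomial_prime_expansion:
  fixes y :: "'r::comm_ring_1"
  assumes p: "Factorial_Ring.prime (p::nat)"
  shows "\<exists>g. (1 + y) ^ p = 1 + of_nat p * y + y ^ p + of_nat p * y\<^sup>2 * g"
proof -
  have p2: "p \<ge> 2" using p by (rule prime_ge_2_nat)
  \<comment> \<open>For \<open>p = 2\<close> the last set is empty and the three inserted indices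
    are still distinct.\<close>
  have split: "{..p} = insert 0 (insert 1 (insert p {2..<p}))" using p2 by auto
  have "(y + 1) ^ p = (\<Sum>k\<le>p. of_nat (p choose k) * y ^ k)"
    by (simp add: binomial_ring)
  also have "\<dots> = 1 + of_nat p * y + y ^ p + (\<Sum>k\<in>{2..<p}. of_nat (p choose k) * y ^ k)"
    unfolding split using p2 by (simp add: add.assoc)
  also have "(\<Sum>k\<in>{2..<p}. of_nat (p choose k) * y ^ k)
      = (\<Sum>k\<in>{2..<p}. of_nat p * y\<^sup>2 * (of_nat ((p choose k) div p) * y ^ (k - 2)))"
  proof (rule sum.cong[OF refl])
    fix k assume k: "k \<in> {2..<p}"
    have "p dvd (p choose k)" using k p by (intro dvd_choose_prime) auto
    then have "p choose k = p * ((p choose k) div p)" by simp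
    then have "(of_nat (p choose k) :: 'r) = of_nat p * of_nat ((p choose k) div p)"
      by (metis of_nat_mult)
    moreover have "y ^ k = y\<^sup>2 * y ^ (k - 2)"
      using k power_add[of y 2 "k - 2"] by (simp only: le_add_diff_inverse atLeastLessThan_iff)
    ultimately show "of_nat (p choose k) * y ^ k
        = of_nat p * y\<^sup>2 * (of_nat ((p choose k) div p) * y ^ (k - 2))"
      by (simp add: ac_simps)
  qed
  finally show ?thesis by (auto simp add: sum_distrib_left[symmetric] add.commute[of y 1])
qed

text \<open>Give \<open>y\<close> weight 1 and \<open>p\<close> weight p - 1. Modulo the ideal
  \<open>I\<close>, the expansion says p y = - y^p - g p y^2: on the right the first term has the
  same weight with one factor \<open>p\<close> less, the second has larger weight. So every monomial
  of weight at least \<open>M\<close> that contains \<open>y\<close> falls into \<open>I\<close>,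
  and p^n y has weight exactly \<open>M\<close>.\<close>

lemma prime_power_mult_mem_ideal:
  fixes y :: "'r::comm_ring_1"
  assumes p: "Factorial_Ring.prime (p::nat)"
    and add: "\<And>f g. f \<in> I \<Longrightarrow> g \<in> I \<Longrightarrow> f + g \<in> I"
    and mult: "\<And>f g. f \<in> I \<Longrightarrow> g * f \<in> I"
    and unip: "(1 + y) ^ p - 1 \<in> I"
    and nilp: "y ^ (n * (p - 1) + 1) \<in> I"
  shows "of_nat p ^ n * y \<in> I"
proof -
  define M where "M = n * (p - 1) + 1"
  have p2: "p \<ge> 2" using p by (rule prime_ge_2_nat)
  obtain g where g: "(1 + y) ^ p = 1 + of_nat p * y + y ^ p + of_nat p * y\<^sup>2 * g"
    using binomial_prime_expansion[OF p] by blast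
  have big: "y ^ b \<in> I" if "b \<ge> M" for b
    using mult[of "y ^ M" "y ^ (b - M)"] nilp[folded M_def] that by (simp flip: power_add)
  \<comment> \<open>The outer induction runs over the number of factors \<open>p\<close>, the inner
    one over the distance of \<open>b\<close> from \<open>M\<close>. The bound
    \<open>b \<ge> 1\<close> is there because the relation can only rewrite \<open>p\<close> next to
    a factor \<open>y\<close>.\<close>
  have "of_nat p ^ a * y ^ b \<in> I" if "b \<ge> 1" "a * (p - 1) + b \<ge> M" for a b
    using that
  proof (induction a arbitrary: b)
    case 0
    then show ?case using big by simp
  next
    case (Suc a)
    show ?case using Suc.prems
    proof (induction "M - b" arbitrary: b rule: less_induct)
      case less
      show ?case
      proof (cases "b \<ge> M")
        case True
        then show ?thesis using big mult by simp
      next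
        case False
        have 1: "of_nat p ^ Suc a * y ^ Suc b \<in> I" 
          by (rule less.hyps) (use False less.prems in auto)
        have "a * (p - 1) + (b + (p - 1)) \<ge> M" using less.prems(2) by (simp add: algebra_simps)
        then have 2: "of_nat p ^ a * y ^ (b + (p - 1)) \<in> I" using less.prems(1) by (intro Suc.IH) auto
        obtain c where c: "b = Suc c" using less.prems(1) by (cases b) auto
        obtain q where q: "p = Suc q" using p2 by (cases p) auto
        \<comment> \<open>The relation multiplied by p^a y^(b-1) and solved for its linear term;
          fact 1 comes from the inner hypothesis, fact 2 from the outer one.\<close>
        have "of_nat p ^ Suc a * y ^ b = (of_nat p ^ a * y ^ c) * ((1 + y) ^ p - 1)
            + ((- 1) * (of_nat p ^ a * y ^ (b + (p - 1))) + (- g) * (of_nat p ^ Suc a * y ^ Suc b))"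
          unfolding g c by (simp add: algebra_simps power2_eq_square q power_add)
        also have "\<dots> \<in> I" using 1 2 unip add mult by blast
        finally show ?thesis .
      qed
    qed
  qed
  from this[of 1 n] show ?thesis by (simp add: M_def)
qed

section \<open>Polynomials in an endomorphism of an abelian group\<close>

locale abelian_endo = comm_group V for V (structure) +
  fixes D :: "'a \<Rightarrow> 'a"
  assumes D_hom: "D \<in> hom V V"
begin

lemma D_closed: "x \<in> carrier V \<Longrightarrow> D x \<in> carrier V"
  using D_hom by (auto simp: hom_def)

lemma D_mult: "x \<in> carrier V \<Longrightarrow> y \<in> carrier V \<Longrightarrow> D (x \<otimes> y) = D x \<otimes> D y"
  using D_hom by (auto simp: hom_def)

lemma D_one: "D \<one> = \<one>"
  using D_hom by (intro hom_one) (auto simp: is_group)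

text \<open>The action of \<open>\<int>[D]\<close> on \<open>V\<close>, in Horner form.\<close>

definition poly_act :: "'a \<Rightarrow> int poly \<Rightarrow> 'a" where
  "poly_act v f = fold_coeffs (\<lambda>a w. v [^] a \<otimes> D w) f \<one>"

lemma poly_act_0: "poly_act v 0 = \<one>"
  by (simp add: poly_act_def)

lemma poly_act_pCons: "poly_act v (pCons a f) = v [^] a \<otimes> D (poly_act v f)"
  by (cases "a = 0 \<and> f = 0") (auto simp: poly_act_def fold_coeffs_def D_one)

lemma poly_act_closed: "v \<in> carrier V \<Longrightarrow> poly_act v f \<in> carrier V"
  by (induction f) (auto simp: poly_act_0 poly_act_pCons D_closed)

lemma poly_act_add:
  assumes v: "v \<in> carrier V"
  shows "poly_act v (f + g) = poly_act v f \<otimes> poly_act v g"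
proof (induction f g rule: poly_induct2)
  case 0
  then show ?case by (simp add: poly_act_0)
next
  case (pCons a f b g)
  then show ?case
    using v by (simp add: poly_act_pCons poly_act_closed D_closed D_mult int_pow_mult m_ac)
qed

lemma poly_act_uminus:
  assumes v: "v \<in> carrier V"
  shows "poly_act v (- f) = inv poly_act v f"
proof -
  have "poly_act v (- f) \<otimes> poly_act v f = \<one>"
    using poly_act_add[OF v, of "- f" f] by (simp add: poly_act_0)
  then show ?thesis using v by (metis inv_equality poly_act_closed)
qed

lemma poly_act_smult_eq_one:
  assumes v: "v \<in> carrier V" and f: "poly_act v f = \<one>"
  shows "poly_act v (Polynomial.smult a f) = \<one>"
proof -
  have "poly_act v (Polynomial.smult (int k) f) = \<one>" for k
    by (induction k) (simp_all add: poly_act_0 smult_add_left poly_act_add[OF v] f)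
  then show ?thesis
    using poly_act_uminus[OF v] by (cases a rule: int_cases2) auto
qed

text \<open>Multiplication by the variable acts as \<open>D\<close>, which fixes the unit. Together
  with \<open>poly_act_add\<close> this makes the annihilator of \<open>v\<close> an ideal of the
  commutative ring of integer polynomials.\<close>

lemma poly_act_mult_eq_one:
  assumes v: "v \<in> carrier V" and f: "poly_act v f = \<one>"
  shows "poly_act v (g * f) = \<one>"
proof (induction g)
  case 0
  then show ?case by (simp add: poly_act_0)
next
  case (pCons a g)
  then show ?case
    using v by (simp add: poly_act_add poly_act_smult_eq_one f poly_act_pCons D_one)
qed

lemma poly_act_monomial_power:
  assumes v: "v \<in> carrier V"
  shows "poly_act v ([:0, 1:] ^ k) = (D ^^ k) v"
proof -
  have "poly_act v 1 = v" using v by (simp add: one_pCons poly_act_pCons poly_act_0 D_one)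
  moreover have "(D ^^ k) v \<in> carrier V" for k using v by (induction k) (auto simp: D_closed)
  ultimately show ?thesis
    by (induction k) (simp_all add: poly_act_pCons D_closed)
qed

text \<open>\<open>V\<close> is written multiplicatively, so 1 + D is the map
  \<open>\<lambda>w. w \<otimes> D w\<close>; in the application it is conjugation by a group
  element.\<close>

lemma poly_act_unipotent_power:
  assumes v: "v \<in> carrier V"
  shows "poly_act v ((1 + [:0, 1:]) ^ k) = ((\<lambda>w. w \<otimes> D w) ^^ k) v"
proof (induction k)
  case 0
  then show ?case using v by (simp add: one_pCons poly_act_pCons poly_act_0 D_one)
next
  case (Suc k)
  have "(1 + [:0, 1:]) ^ Suc k = (1 + [:0, 1:]) ^ k + pCons 0 ((1 + [:0, 1::int:]) ^ k)"
    by (simp add: distrib_right)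
  then have "poly_act v ((1 + [:0, 1:]) ^ Suc k)
     = poly_act v ((1 + [:0, 1:]) ^ k) \<otimes> D (poly_act v ((1 + [:0, 1:]) ^ k))"
    using v by (simp only: poly_act_add poly_act_pCons) (simp add: poly_act_closed D_closed)
  then show ?case using Suc by simp
qed

text \<open>Both hypotheses concern the single vector \<open>v\<close>: they place (1 + X)^p - 1 and
  X^(n(p-1)+1) in the annihilator of \<open>v\<close>, so the ideal lemma places p^n X there
  too.\<close>

lemma endo_prime_power_eq_one:
  assumes p: "Factorial_Ring.prime (p::nat)" and v: "v \<in> carrier V"
    and nilp: "(D ^^ (n * (p - 1) + 1)) v = \<one>"
    and per: "((\<lambda>w. w \<otimes> D w) ^^ p) v = v"
  shows "D v [^] (p ^ n) = \<one>"
proof -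
  define I where "I = {f. poly_act v f = \<one>}"
  have p1: "poly_act v 1 = v" using poly_act_monomial_power[OF v, of 0] by simp
  have "(of_nat p :: int poly) ^ n * [:0, 1:] \<in> I"
  proof (rule prime_power_mult_mem_ideal[OF p])
    show "f + g \<in> I" if "f \<in> I" "g \<in> I" for f g using that v by (simp add: I_def poly_act_add)
    show "g * f \<in> I" if "f \<in> I" for f g using that v by (simp add: I_def poly_act_mult_eq_one)
    have "poly_act v ((1 + [:0, 1:]) ^ p + (- 1)) = v \<otimes> inv v"
      by (simp only: poly_act_add[OF v] poly_act_unipotent_power[OF v] per poly_act_uminus[OF v] p1)
    then show "(1 + [:0, 1:]) ^ p - 1 \<in> I" using v by (simp add: I_def)
    show "[:0, 1:] ^ (n * (p - 1) + 1) \<in> I"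
      unfolding I_def mem_Collect_eq poly_act_monomial_power[OF v] by (rule nilp)
  qed
  moreover have "(of_nat p :: int poly) ^ n * [:0, 1:] = [:0, int (p ^ n):]"
    by (simp add: of_nat_poly poly_const_pow)
  \<comment> \<open>The Horner form of the polynomial with coefficients 0 and p^n, unfolded at
    \<open>v\<close>.\<close>
  ultimately have "\<one> \<otimes> D (v [^] int (p ^ n) \<otimes> \<one>) = \<one>"
    by (simp add: I_def poly_act_pCons poly_act_0 D_one del: of_nat_power)
  then have "D (v [^] (p ^ n)) = \<one>" using v by (simp add: int_pow_int D_closed del: of_nat_power)
  moreover have "D (v [^] k) = D v [^] k" for k :: nat
    using v by (induction k) (simp_all add: D_one D_mult)
  ultimately show ?thesis by simp
qed

end

section \<open>Saturated fusion systems\<close>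

lemma (in group_hom) card_image_dvd_order:
  shows "card (h ` carrier G) dvd order G"
proof -
  \<comment> \<open>Cutting the codomain down to the image makes \<open>h\<close> surjective, as
    \<open>FactGroup_iso_set\<close> demands.\<close>
  define H' where "H' = H\<lparr>carrier := h ` carrier G\<rparr>"
  have "subgroup (h ` carrier G) H" by (rule img_is_subgroup)
  then have "group H'" unfolding H'_def by (rule H.subgroup_imp_group)
  moreover have "h \<in> hom G H'" by (auto simp: hom_def H'_def)
  ultimately interpret h': group_hom G H' h
    by (simp add: group_hom_def group_hom_axioms_def is_group)
  have "(\<lambda>M. the_elem (h ` M)) \<in> iso (G Mod kernel G H' h) H'"
    by (rule h'.FactGroup_iso_set) (simp add: H'_def)
  then have "card (carrier (G Mod kernel G H' h)) = card (carrier H')"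
    unfolding iso_def using bij_betw_same_card by blast
  then have "card (h ` carrier G) = card (rcosets (kernel G H' h))"
    by (simp add: FactGroup_def H'_def)
  then show ?thesis
    using G.lagrange[OF h'.subgroup_kernel] by (metis dvd_triv_left)
qed

locale saturated_fusion = group P for P (structure) +
  fixes Hom :: "'a set \<Rightarrow> 'a set \<Rightarrow> ('a \<Rightarrow> 'a) set" and p :: nat
  assumes prime_p: "Factorial_Ring.prime p"
    and finite_P: "finite (carrier P)"
    and p_group_P: "\<exists>a. card (carrier P) = p ^ a"
    and saturated: "saturated_fusion_system P Hom p"
begin

lemma fusion_category: "fusion_category P Hom"
  using saturated by (simp add: saturated_fusion_system_def)

lemmas Hom_axiom_hom = fusion_category[unfolded fusion_category_def, THEN conjunct1, rule_format]
lemmas Hom_axiom_comp = fusion_category[unfolded fusion_category_def, THEN conjunct2, THEN conjunct2,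
    THEN conjunct1, rule_format]
lemmas Hom_axiom_factor = fusion_category[unfolded fusion_category_def, THEN conjunct2, THEN conjunct2,
    THEN conjunct2, rule_format]

section \<open>Elementary properties of morphisms\<close>

lemma finite_subgroup: "subgroup Q P \<Longrightarrow> finite Q"
  using finite_P by (meson finite_subset subgroup.subset)

text \<open>All morphism sets are determined by those with codomain \<open>P\<close>. Below,
  morphisms are therefore taken in \<open>Hom Q (carrier P)\<close> and their targets are controlled
  through images.\<close>

lemma Hom_iff:
  assumes "subgroup Q P" "subgroup R P"
  shows "\<phi> \<in> Hom Q R \<longleftrightarrow> \<phi> \<in> Hom Q (carrier P) \<and> \<phi> ` Q \<subseteq> R"
proof
  assume h: "\<phi> \<in> Hom Q R"
  then have "\<phi> \<in> hom (P\<lparr>carrier := Q\<rparr>) (P\<lparr>carrier := R\<rparr>)"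
    using Hom_axiom_hom[OF assms] by blast
  then have "\<phi> ` Q \<subseteq> R" by (auto simp: hom_def)
  moreover from this have "\<phi> ` Q \<subseteq> carrier P" using assms subgroup.subset by blast
  ultimately show "\<phi> \<in> Hom Q (carrier P) \<and> \<phi> ` Q \<subseteq> R"
    using Hom_axiom_factor[OF assms h] subgroup_self by blast
next
  assume "\<phi> \<in> Hom Q (carrier P) \<and> \<phi> ` Q \<subseteq> R"
  then show "\<phi> \<in> Hom Q R"
    using Hom_axiom_factor[OF assms(1) subgroup_self, of \<phi>] assms(2) by blast
qed

context
  fixes Q \<phi>
  assumes Q: "subgroup Q P" and \<phi>: "\<phi> \<in> Hom Q (carrier P)"
begin

lemma Hom_hom: "\<phi> \<in> hom (P\<lparr>carrier := Q\<rparr>) P"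
  using Hom_axiom_hom[OF Q subgroup_self \<phi>] by simp

lemma Hom_extensional: "\<phi> \<in> extensional Q"
  using Hom_axiom_hom[OF Q subgroup_self \<phi>] by simp

lemma Hom_inj: "inj_on \<phi> Q"
  using Hom_axiom_hom[OF Q subgroup_self \<phi>] by simp

lemma Hom_mult: "x \<in> Q \<Longrightarrow> y \<in> Q \<Longrightarrow> \<phi> (x \<otimes> y) = \<phi> x \<otimes> \<phi> y"
  using Hom_hom by (auto simp: hom_def)

lemma Hom_closed: "x \<in> Q \<Longrightarrow> \<phi> x \<in> carrier P"
  using Hom_hom by (auto simp: hom_def)

lemma Hom_group_hom: "group_hom (P\<lparr>carrier := Q\<rparr>) P \<phi>"
  using Hom_hom Q subgroup_imp_group by (simp add: group_hom_def group_hom_axioms_def is_group)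

lemma Hom_image_subgroup: "subgroup (\<phi> ` Q) P"
  using group_hom.img_is_subgroup[OF Hom_group_hom] by simp

lemma Hom_inv: "x \<in> Q \<Longrightarrow> \<phi> (inv x) = inv \<phi> x"
  using group_hom.hom_inv[OF Hom_group_hom, of x] Q by (simp add: m_inv_consistent)

lemma Hom_pow: "x \<in> Q \<Longrightarrow> \<phi> (x [^] (k::nat)) = \<phi> x [^] k"
  using group_hom.hom_nat_pow[OF Hom_group_hom, of x k]
  by (simp add: nat_pow_consistent[symmetric])

lemma Hom_conj: "x \<in> Q \<Longrightarrow> y \<in> Q \<Longrightarrow> \<phi> (x \<otimes> y \<otimes> inv x) = \<phi> x \<otimes> \<phi> y \<otimes> inv \<phi> x"
  using Q by (simp add: Hom_mult Hom_inv subgroup.m_closed subgroup.m_inv_closed)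

lemma Hom_card_image: "card (\<phi> ` Q) = card Q"
  using Hom_inj by (rule card_image)

lemma Hom_inverse: "restrict (inv_into Q \<phi>) (\<phi> ` Q) \<in> Hom (\<phi> ` Q) (carrier P)"
proof -
  have "restrict (inv_into Q \<phi>) (\<phi> ` Q) \<in> Hom (\<phi> ` Q) Q"
    using Hom_axiom_factor[OF Q subgroup_self \<phi>] by blast
  then show ?thesis using Hom_iff[OF Hom_image_subgroup Q] by blast
qed

lemma Hom_comp:
  assumes R: "subgroup R P" and sub: "\<phi> ` Q \<subseteq> R" and \<psi>: "\<psi> \<in> Hom R (carrier P)"
  shows "compose Q \<psi> \<phi> \<in> Hom Q (carrier P)"
proof -
  have "\<phi> \<in> Hom Q R" using Hom_iff[OF Q R] \<phi> sub by blast
  then have "restrict (\<psi> \<circ> \<phi>) Q \<in> Hom Q (carrier P)"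
    using Hom_axiom_comp[OF Q R subgroup_self _ \<psi>] by blast
  then show ?thesis by (simp add: compose_def comp_def)
qed

end

lemma Hom_conjmap:
  assumes "subgroup Q P" "x \<in> carrier P"
  shows "conjmap P x Q \<in> Hom Q (carrier P)"
proof -
  have "(\<lambda>z. x \<otimes> z \<otimes> inv x) ` Q \<subseteq> carrier P"
    using assms subgroup.subset by fastforce
  then show ?thesis
    using saturated[unfolded saturated_fusion_system_def, THEN conjunct2, THEN conjunct1, rule_format]
      assms subgroup_self by blast
qed

lemma Hom_id:
  assumes "subgroup Q P"
  shows "(\<lambda>x\<in>Q. x) \<in> Hom Q (carrier P)"
proof -
  have "conjmap P \<one> Q = (\<lambda>x\<in>Q. x)"
    using subgroup.subset[OF assms] by (auto simp: conjmap_def subset_iff)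
  then show ?thesis using Hom_conjmap[OF assms, of \<one>] by simp
qed

lemma Hom_restrict:
  assumes Q: "subgroup Q P" and \<phi>: "\<phi> \<in> Hom Q (carrier P)" and R: "subgroup R P" "R \<subseteq> Q"
  shows "restrict \<phi> R \<in> Hom R (carrier P)"
proof -
  have "compose R \<phi> (\<lambda>x\<in>R. x) \<in> Hom R (carrier P)"
    by (rule Hom_comp[OF R(1) Hom_id[OF R(1)] Q _ \<phi>]) (use R(2) in auto)
  moreover have "compose R \<phi> (\<lambda>x\<in>R. x) = restrict \<phi> R"
    by (auto simp: compose_def)
  ultimately show ?thesis by simp
qed

section \<open>The groups Aut_F(Q) and Aut_P(Q)\<close>

definition AutF :: "'a set \<Rightarrow> ('a \<Rightarrow> 'a) monoid" where
  "AutF Q = (BijGroup Q)\<lparr>carrier := Hom Q Q\<rparr>"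

definition AutP :: "'a set \<Rightarrow> ('a \<Rightarrow> 'a) set" where
  "AutP Q = (\<lambda>x. conjmap P x Q) ` normalizer_in P Q"

text \<open>Injective self-maps of a finite set are onto; this is why \<open>Hom Q Q\<close> can
  serve as the carrier of the group Aut_F(Q).\<close>

lemma Aut_image:
  assumes "subgroup Q P" "f \<in> Hom Q Q"
  shows "f ` Q = Q"
proof (rule endo_inj_surj)
  show "finite Q" using assms(1) by (rule finite_subgroup)
  have f: "f \<in> Hom Q (carrier P)" "f ` Q \<subseteq> Q" using assms Hom_iff[OF assms(1,1)] by auto
  then show "f ` Q \<subseteq> Q" "inj_on f Q" using Hom_inj[OF assms(1)] by auto
qed

lemma Aut_iff:
  assumes "subgroup Q P"
  shows "f \<in> Hom Q Q \<longleftrightarrow> f \<in> Hom Q (carrier P) \<and> f ` Q = Q"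
  using Aut_image[OF assms, of f] Hom_iff[OF assms assms, of f] by blast

lemma Aut_Bij:
  assumes "subgroup Q P" "f \<in> Hom Q Q"
  shows "f \<in> Bij Q"
proof -
  have f: "f \<in> Hom Q (carrier P)" "f ` Q = Q" using assms(2) unfolding Aut_iff[OF assms(1)] by auto
  then show ?thesis
    using Hom_inj[OF assms(1) f(1)] Hom_extensional[OF assms(1) f(1)] by (simp add: Bij_def bij_betw_def)
qed

lemma subgroup_Hom_BijGroup:
  assumes Q: "subgroup Q P"
  shows "subgroup (Hom Q Q) (BijGroup Q)"
proof (rule group.subgroupI[OF group_BijGroup])
  show "Hom Q Q \<subseteq> carrier (BijGroup Q)" using Aut_Bij[OF Q] by (auto simp: BijGroup_def)
  show "Hom Q Q \<noteq> {}" using Hom_id[OF Q] Aut_iff[OF Q] by force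
next
  fix f assume f: "f \<in> Hom Q Q"
  then have "f \<in> Hom Q (carrier P)" "f ` Q = Q" by (auto simp: Aut_iff[OF Q])
  then have "restrict (inv_into Q f) Q \<in> Hom Q (carrier P)" using Hom_inverse[OF Q] by metis
  moreover have "inv_into Q f ` Q = Q"
    using Aut_Bij[OF Q f] by (simp add: Bij_def bij_betw_def) (metis bij_betw_def bij_betw_inv_into)
  ultimately show "inv\<^bsub>BijGroup Q\<^esub> f \<in> Hom Q Q"
    using Aut_Bij[OF Q f] by (simp add: inv_BijGroup Aut_iff[OF Q])
next
  fix f g assume f: "f \<in> Hom Q Q" and g: "g \<in> Hom Q Q"
  have "compose Q f g \<in> Hom Q (carrier P)"
    using f g Hom_comp[OF Q _ Q] by (simp add: Aut_iff[OF Q])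
  moreover have "compose Q f g ` Q = Q"
    using f g by (simp add: Aut_iff[OF Q] compose_def flip: image_image)
  ultimately show "f \<otimes>\<^bsub>BijGroup Q\<^esub> g \<in> Hom Q Q"
    using Aut_Bij[OF Q f] Aut_Bij[OF Q g] by (simp add: BijGroup_def Aut_iff[OF Q])
qed

lemma group_AutF: "subgroup Q P \<Longrightarrow> group (AutF Q)"
  unfolding AutF_def by (rule group.subgroup_imp_group[OF group_BijGroup subgroup_Hom_BijGroup])

lemma carrier_AutF: "carrier (AutF Q) = Hom Q Q"
  by (simp add: AutF_def)

lemma finite_AutF: "subgroup Q P \<Longrightarrow> finite (carrier (AutF Q))"
proof -
  assume Q: "subgroup Q P"
  have "Hom Q Q \<subseteq> Q \<rightarrow>\<^sub>E Q" using Aut_Bij[OF Q] by (auto simp: Bij_def bij_betw_def PiE_def)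
  then show ?thesis
    using finite_PiE[of Q "\<lambda>_. Q"] finite_subgroup[OF Q] finite_subset by (auto simp: carrier_AutF)
qed

lemma AutF_mult:
  assumes Q: "subgroup Q P" and "f \<in> Hom Q Q" "g \<in> Hom Q Q"
  shows "f \<otimes>\<^bsub>AutF Q\<^esub> g = compose Q f g"
  using Aut_Bij[OF Q] assms by (simp add: AutF_def BijGroup_def)

lemma AutF_one: "\<one>\<^bsub>AutF Q\<^esub> = (\<lambda>x\<in>Q. x)"
  by (simp add: AutF_def BijGroup_def)

lemma AutF_eqI:
  assumes Q: "subgroup Q P" and "f \<in> Hom Q Q" "g \<in> Hom Q Q" and "\<And>z. z \<in> Q \<Longrightarrow> f z = g z"
  shows "f = g"
  using assms Hom_extensional[OF Q] by (metis Aut_iff extensionalityI)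

lemma Aut_closed: "subgroup Q P \<Longrightarrow> f \<in> Hom Q Q \<Longrightarrow> z \<in> Q \<Longrightarrow> f z \<in> Q"
  using Aut_image by blast

text \<open>Moving the inverse to the other side turns a conjugation in Aut_F(Q) into a pointwise
  identity of the shape found in the definition of \<open>N_phi\<close>.\<close>

lemma AutF_conj_iff:
  assumes Q: "subgroup Q P" and f: "f \<in> Hom Q Q" and g: "g \<in> Hom Q Q" and h: "h \<in> Hom Q Q"
  shows "f \<otimes>\<^bsub>AutF Q\<^esub> g \<otimes>\<^bsub>AutF Q\<^esub> inv\<^bsub>AutF Q\<^esub> f = h \<longleftrightarrow> (\<forall>z \<in> Q. f (g z) = h (f z))"
proof -
  interpret A: group "AutF Q" using Q by (rule group_AutF)
  have fg: "f \<otimes>\<^bsub>AutF Q\<^esub> g \<in> Hom Q Q" and hf: "h \<otimes>\<^bsub>AutF Q\<^esub> f \<in> Hom Q Q"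
    using f g h A.m_closed by (auto simp: carrier_AutF)
  have "f \<otimes>\<^bsub>AutF Q\<^esub> g \<otimes>\<^bsub>AutF Q\<^esub> inv\<^bsub>AutF Q\<^esub> f = h \<longleftrightarrow> f \<otimes>\<^bsub>AutF Q\<^esub> g = h \<otimes>\<^bsub>AutF Q\<^esub> f"
    using A.inv_solve_right'[of h "f \<otimes>\<^bsub>AutF Q\<^esub> g" f] f h fg by (simp add: carrier_AutF)
  also have "\<dots> \<longleftrightarrow> (\<forall>z \<in> Q. (f \<otimes>\<^bsub>AutF Q\<^esub> g) z = (h \<otimes>\<^bsub>AutF Q\<^esub> f) z)"
    using AutF_eqI[OF Q fg hf] by auto
  also have "\<dots> \<longleftrightarrow> (\<forall>z \<in> Q. f (g z) = h (f z))"
    using f g h by (simp add: AutF_mult[OF Q] compose_def)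
  finally show ?thesis .
qed

lemma AutF_pow:
  assumes Q: "subgroup Q P" and f: "f \<in> Hom Q Q"
  shows "\<forall>z \<in> Q. (f [^]\<^bsub>AutF Q\<^esub> (k::nat)) z = (f ^^ k) z"
proof (induction k)
  case 0
  show ?case by (simp add: AutF_one)
next
  case (Suc k)
  have "f [^]\<^bsub>AutF Q\<^esub> k \<in> Hom Q Q"
    using monoid.nat_pow_closed[OF group.is_monoid[OF group_AutF[OF Q]]] f by (simp add: carrier_AutF)
  then show ?case
    using Suc f Aut_closed[OF Q f] by (simp add: AutF_mult[OF Q] compose_def funpow_swap1)
qed

lemma normalizer_subgroup: "subgroup Q P \<Longrightarrow> subgroup (normalizer_in P Q) P"
  by (simp add: normalizer_in_subgroup subgroup.subset)

lemma conjmap_Aut: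
  assumes Q: "subgroup Q P" and x: "x \<in> normalizer_in P Q"
  shows "conjmap P x Q \<in> Hom Q Q"
  using Hom_conjmap[OF Q] x by (auto simp: Aut_iff[OF Q] normalizer_in_def conjmap_def)

lemma conjmap_hom:
  assumes Q: "subgroup Q P"
  shows "group_hom (P\<lparr>carrier := normalizer_in P Q\<rparr>) (AutF Q) (\<lambda>x. conjmap P x Q)"
proof -
  have "conjmap P (x \<otimes> y) Q = conjmap P x Q \<otimes>\<^bsub>AutF Q\<^esub> conjmap P y Q"
    if xy: "x \<in> normalizer_in P Q" "y \<in> normalizer_in P Q" for x y
  proof -
    have c: "x \<in> carrier P" "y \<in> carrier P" using xy by (auto simp: normalizer_in_def)
    have "conjmap P (x \<otimes> y) Q = compose Q (conjmap P x Q) (conjmap P y Q)"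
    proof
      fix z
      show "conjmap P (x \<otimes> y) Q z = compose Q (conjmap P x Q) (conjmap P y Q) z"
      proof (cases "z \<in> Q")
        case True
        then have "z \<in> carrier P" "y \<otimes> z \<otimes> inv y \<in> Q"
          using xy subgroup.subset[OF Q] by (auto simp: normalizer_in_def)
        then show ?thesis
          using True c by (simp add: conjmap_def compose_def inv_mult_group m_assoc)
      qed (simp add: conjmap_def compose_def)
    qed
    then show ?thesis using AutF_mult[OF Q] conjmap_Aut[OF Q] xy by simp
  qed
  then have "(\<lambda>x. conjmap P x Q) \<in> hom (P\<lparr>carrier := normalizer_in P Q\<rparr>) (AutF Q)"
    using conjmap_Aut[OF Q] by (simp add: hom_def carrier_AutF Pi_iff)
  then show ?thesis
    using group_AutF[OF Q] subgroup_imp_group[OF normalizer_subgroup[OF Q]]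
    by (simp add: group_hom_def group_hom_axioms_def)
qed

lemma AutP_subgroup: "subgroup Q P \<Longrightarrow> subgroup (AutP Q) (AutF Q)"
  using group_hom.img_is_subgroup[OF conjmap_hom] by (simp add: AutP_def)

lemma card_subgroup_p_power:
  assumes "subgroup Q P"
  shows "\<exists>k. card Q = p ^ k"
proof -
  obtain a where a: "card (carrier P) = p ^ a" using p_group_P by blast
  have "card Q dvd p ^ a" using lagrange[OF assms] by (metis a dvd_triv_right order_def)
  then show ?thesis using divides_primepow_nat[OF prime_p] by blast
qed

lemma card_AutP_p_power:
  assumes Q: "subgroup Q P"
  shows "\<exists>k. card (AutP Q) = p ^ k"
proof -
  obtain k where k: "card (normalizer_in P Q) = p ^ k"
    using card_subgroup_p_power normalizer_subgroup[OF Q] by blast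
  have "card (AutP Q) dvd p ^ k"
    using group_hom.card_image_dvd_order[OF conjmap_hom[OF Q]] k by (simp add: AutP_def order_def)
  then show ?thesis using divides_primepow_nat[OF prime_p] by blast
qed

lemma mem_AutP_iff:
  assumes Q: "subgroup Q P" and f: "f \<in> Hom Q Q"
  shows "f \<in> AutP Q \<longleftrightarrow> (\<exists>y \<in> normalizer_in P Q. \<forall>z \<in> Q. f z = y \<otimes> z \<otimes> inv y)"
proof
  assume "f \<in> AutP Q"
  then show "\<exists>y \<in> normalizer_in P Q. \<forall>z \<in> Q. f z = y \<otimes> z \<otimes> inv y"
    by (auto simp: AutP_def conjmap_def)
next
  assume "\<exists>y \<in> normalizer_in P Q. \<forall>z \<in> Q. f z = y \<otimes> z \<otimes> inv y"
  then obtain y where y: "y \<in> normalizer_in P Q" "\<forall>z \<in> Q. f z = y \<otimes> z \<otimes> inv y" by blast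
  have "f = conjmap P y Q"
    by (rule AutF_eqI[OF Q f conjmap_Aut[OF Q y(1)]]) (simp add: y(2) conjmap_def)
  then show "f \<in> AutP Q" using y(1) by (simp add: AutP_def)
qed

section \<open>Extending morphisms, and fully normalized images\<close>

lemma normalizer_inI:
  assumes Q: "subgroup Q P" and x: "x \<in> carrier P" and "\<And>z. z \<in> Q \<Longrightarrow> x \<otimes> z \<otimes> inv x \<in> Q"
  shows "x \<in> normalizer_in P Q"
  using assms normalizer_in_alt[OF subgroup.subset[OF Q] finite_P] by blast

lemma normalizer_in_conj: "x \<in> normalizer_in P Q \<Longrightarrow> z \<in> Q \<Longrightarrow> x \<otimes> z \<otimes> inv x \<in> Q"
  by (auto simp: normalizer_in_def)

text \<open>The witnesses y multiply and invert along with x, and an x in \<open>Q\<close> has the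
  witness \<open>\<phi> x\<close>. So an extension to \<open>N_phi\<close> is a proper one as soon
  as \<open>N_phi\<close> differs from \<open>Q\<close>.\<close>

lemma N_phi_subgroup:
  assumes Q: "subgroup Q P" and \<phi>: "\<phi> \<in> Hom Q (carrier P)"
  shows "subgroup (N_phi P Q \<phi>) P" and "Q \<subseteq> N_phi P Q \<phi>"
proof -
  define Q' where "Q' = \<phi> ` Q"
  have Q': "subgroup Q' P" unfolding Q'_def by (rule Hom_image_subgroup[OF Q \<phi>])
  have nQ: "subgroup (normalizer_in P Q) P" and nQ': "subgroup (normalizer_in P Q') P"
    using normalizer_subgroup Q Q' by auto
  have Nc: "x \<in> carrier P" if "x \<in> normalizer_in P R" for x R using that by (simp add: normalizer_in_def)
  have QG: "x \<in> carrier P" if "x \<in> Q" for x using that subgroup.subset[OF Q] by blast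
  show sub: "Q \<subseteq> N_phi P Q \<phi>"
  proof
    fix x assume x: "x \<in> Q"
    have "x \<in> normalizer_in P Q" using subset_normalizer_in[OF Q finite_P] x by blast
    moreover have "\<phi> x \<in> normalizer_in P Q'"
      using subset_normalizer_in[OF Q' finite_P] x by (auto simp: Q'_def)
    ultimately show "x \<in> N_phi P Q \<phi>"
      unfolding N_phi_def Q'_def[symmetric] using Hom_conj[OF Q \<phi> x] by blast
  qed
  show "subgroup (N_phi P Q \<phi>) P"
  proof (rule subgroupI)
    show "N_phi P Q \<phi> \<subseteq> carrier P" using Nc by (auto simp: N_phi_def)
    show "N_phi P Q \<phi> \<noteq> {}" using sub subgroup.one_closed[OF Q] by blast
  next
    fix x assume "x \<in> N_phi P Q \<phi>"
    then obtain y where x: "x \<in> normalizer_in P Q" and y: "y \<in> normalizer_in P Q'"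
      and xy: "\<And>z. z \<in> Q \<Longrightarrow> \<phi> (x \<otimes> z \<otimes> inv x) = y \<otimes> \<phi> z \<otimes> inv y"
      by (auto simp: N_phi_def Q'_def)
    have ix: "inv x \<in> normalizer_in P Q" and iy: "inv y \<in> normalizer_in P Q'"
      using x y nQ nQ' by (auto simp: subgroup.m_inv_closed)
    have "\<phi> (inv x \<otimes> z \<otimes> inv (inv x)) = inv y \<otimes> \<phi> z \<otimes> inv (inv y)" if z: "z \<in> Q" for z
    proof -
      define w where "w = inv x \<otimes> z \<otimes> inv (inv x)"
      have w: "w \<in> Q" unfolding w_def by (rule normalizer_in_conj[OF ix z])
      have "x \<otimes> w \<otimes> inv x = z" using Nc[OF x] QG[OF z] by (simp add: w_def m_assoc inv_mult_cancel_left)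
      then have "\<phi> z = y \<otimes> \<phi> w \<otimes> inv y" using xy[OF w] by simp
      then have "inv y \<otimes> \<phi> z \<otimes> inv (inv y) = \<phi> w"
        using Nc[OF y] Hom_closed[OF Q \<phi> w] by (simp add: m_assoc inv_mult_cancel_left)
      then show ?thesis by (simp add: w_def)
    qed
    then show "inv x \<in> N_phi P Q \<phi>" using ix iy by (auto simp: N_phi_def Q'_def)
  next
    fix x x' assume "x \<in> N_phi P Q \<phi>" "x' \<in> N_phi P Q \<phi>"
    then obtain y y' where x: "x \<in> normalizer_in P Q" "x' \<in> normalizer_in P Q"
      and y: "y \<in> normalizer_in P Q'" "y' \<in> normalizer_in P Q'"
      and xy: "\<And>z. z \<in> Q \<Longrightarrow> \<phi> (x \<otimes> z \<otimes> inv x) = y \<otimes> \<phi> z \<otimes> inv y"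
      and xy': "\<And>z. z \<in> Q \<Longrightarrow> \<phi> (x' \<otimes> z \<otimes> inv x') = y' \<otimes> \<phi> z \<otimes> inv y'"
      unfolding N_phi_def Q'_def by blast
    have "\<phi> (x \<otimes> x' \<otimes> z \<otimes> inv (x \<otimes> x')) = y \<otimes> y' \<otimes> \<phi> z \<otimes> inv (y \<otimes> y')" if z: "z \<in> Q" for z
    proof -
      have "x \<otimes> x' \<otimes> z \<otimes> inv (x \<otimes> x') = x \<otimes> (x' \<otimes> z \<otimes> inv x') \<otimes> inv x"
        using Nc x QG[OF z] by (simp add: m_assoc inv_mult_group)
      then have "\<phi> (x \<otimes> x' \<otimes> z \<otimes> inv (x \<otimes> x')) = y \<otimes> (y' \<otimes> \<phi> z \<otimes> inv y') \<otimes> inv y"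
        using xy[OF normalizer_in_conj[OF x(2) z]] xy'[OF z] by simp
      then show ?thesis using Nc y Hom_closed[OF Q \<phi> z] by (simp add: m_assoc inv_mult_group)
    qed
    then show "x \<otimes> x' \<in> N_phi P Q \<phi>"
      using subgroup.m_closed[OF nQ x] subgroup.m_closed[OF nQ' y]
      unfolding N_phi_def Q'_def[symmetric] by blast
  qed
qed

lemma extension:
  assumes Q: "subgroup Q P" and \<phi>: "\<phi> \<in> Hom Q (carrier P)"
    and fn: "fully_normalized P Hom (\<phi> ` Q)"
  shows "\<exists>\<psi> \<in> Hom (N_phi P Q \<phi>) (carrier P). \<forall>z \<in> Q. \<psi> z = \<phi> z"
proof -
  have "subgroup (\<phi> ` Q) P" by (rule Hom_image_subgroup[OF Q \<phi>])
  then have "fusion_iso Hom Q (\<phi> ` Q) \<phi>"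
    using Hom_iff[OF Q, of "\<phi> ` Q" \<phi>] \<phi> by (simp add: fusion_iso_def)
  then show ?thesis
    using saturated[unfolded saturated_fusion_system_def, THEN conjunct2, THEN conjunct2, THEN conjunct2,
        rule_format] Q \<open>subgroup (\<phi> ` Q) P\<close> fn by blast
qed

text \<open>Take an image of \<open>Q\<close> whose normalizer is as large as possible; everything
  isomorphic to that image is again an image of \<open>Q\<close>, by composition.\<close>

lemma exists_fully_normalized:
  assumes Q: "subgroup Q P"
  shows "\<exists>\<phi> \<in> Hom Q (carrier P). fully_normalized P Hom (\<phi> ` Q)"
proof -
  define f where "f = (\<lambda>\<phi>. card (normalizer_in P (\<phi> ` Q)))"
  have "f \<phi> < Suc (card (carrier P))" for \<phi>
    unfolding f_def less_Suc_eq_le by (rule card_mono[OF finite_P]) (auto simp: normalizer_in_def)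
  then have "\<exists>\<phi>. \<phi> \<in> Hom Q (carrier P) \<and> (\<forall>\<psi>. \<psi> \<in> Hom Q (carrier P) \<longrightarrow> f \<psi> \<le> f \<phi>)"
    using ex_has_greatest_nat[of "\<lambda>\<phi>. \<phi> \<in> Hom Q (carrier P)" "\<lambda>x\<in>Q. x" f
        "Suc (card (carrier P))"] Hom_id[OF Q] by simp
  then obtain \<phi> where \<phi>: "\<phi> \<in> Hom Q (carrier P)"
    and max: "\<And>\<psi>. \<psi> \<in> Hom Q (carrier P) \<Longrightarrow> f \<psi> \<le> f \<phi>" by blast
  have R: "subgroup (\<phi> ` Q) P" by (rule Hom_image_subgroup[OF Q \<phi>])
  have "card (normalizer_in P Q'') \<le> card (normalizer_in P (\<phi> ` Q))"
    if Q'': "subgroup Q'' P" and iso: "fusion_iso Hom (\<phi> ` Q) Q'' \<chi>" for Q'' \<chi>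
  proof -
    have \<chi>: "\<chi> \<in> Hom (\<phi> ` Q) (carrier P)" "\<chi> ` (\<phi> ` Q) = Q''"
      using iso Hom_iff[OF R Q''] by (auto simp: fusion_iso_def)
    have "compose Q \<chi> \<phi> \<in> Hom Q (carrier P)" by (rule Hom_comp[OF Q \<phi> R _ \<chi>(1)]) simp
    moreover have "compose Q \<chi> \<phi> ` Q = Q''" using \<chi>(2) by (auto simp: compose_def image_image)
    ultimately show ?thesis using max[of "compose Q \<chi> \<phi>"] by (simp add: f_def)
  qed
  then have "fully_normalized P Hom (\<phi> ` Q)" using R unfolding fully_normalized_def by blast
  then show ?thesis using \<phi> by blast
qed

definition transport :: "'a set \<Rightarrow> ('a \<Rightarrow> 'a) \<Rightarrow> ('a \<Rightarrow> 'a) \<Rightarrow> 'a \<Rightarrow> 'a" where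
  "transport Q \<alpha> u = (\<lambda>z \<in> \<alpha> ` Q. \<alpha> (u (inv_into Q \<alpha> z)))"

lemma transport_apply:
  assumes Q: "subgroup Q P" and \<alpha>: "\<alpha> \<in> Hom Q (carrier P)" and "z \<in> Q"
  shows "transport Q \<alpha> u (\<alpha> z) = \<alpha> (u z)"
  using assms Hom_inj[OF Q \<alpha>] by (simp add: transport_def)

lemma transport_Aut:
  assumes Q: "subgroup Q P" and \<alpha>: "\<alpha> \<in> Hom Q (carrier P)" and u: "u \<in> Hom Q Q"
  shows "transport Q \<alpha> u \<in> Hom (\<alpha> ` Q) (\<alpha> ` Q)"
proof -
  have Q': "subgroup (\<alpha> ` Q) P" by (rule Hom_image_subgroup[OF Q \<alpha>])
  have u': "u \<in> Hom Q (carrier P)" "u ` Q = Q" using u by (auto simp: Aut_iff[OF Q])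
  have i: "restrict (inv_into Q \<alpha>) (\<alpha> ` Q) \<in> Hom (\<alpha> ` Q) (carrier P)" by (rule Hom_inverse[OF Q \<alpha>])
  have iim: "inv_into Q \<alpha> ` \<alpha> ` Q = Q" using Hom_inj[OF Q \<alpha>] by (simp add: inv_into_image_cancel)
  have au: "compose Q \<alpha> u \<in> Hom Q (carrier P)" by (rule Hom_comp[OF Q u'(1) Q _ \<alpha>]) (simp add: u'(2))
  have "compose (\<alpha> ` Q) (compose Q \<alpha> u) (restrict (inv_into Q \<alpha>) (\<alpha> ` Q)) \<in> Hom (\<alpha> ` Q) (carrier P)"
    by (rule Hom_comp[OF Q' i Q _ au]) (simp add: iim)
  moreover have "compose (\<alpha> ` Q) (compose Q \<alpha> u) (restrict (inv_into Q \<alpha>) (\<alpha> ` Q)) = transport Q \<alpha> u"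
    by (auto simp: transport_def compose_def fun_eq_iff inv_into_into)
  moreover have "transport Q \<alpha> u ` \<alpha> ` Q = \<alpha> ` Q"
  proof -
    have "transport Q \<alpha> u ` \<alpha> ` Q = (\<lambda>z. \<alpha> (u z)) ` Q"
      unfolding image_image by (rule image_cong[OF refl]) (rule transport_apply[OF Q \<alpha>])
    also have "\<dots> = \<alpha> ` Q" by (simp add: u'(2) flip: image_image)
    finally show ?thesis .
  qed
  ultimately show ?thesis by (simp add: Aut_iff[OF Q'])
qed

lemma transport_subgroup:
  assumes Q: "subgroup Q P" and \<alpha>: "\<alpha> \<in> Hom Q (carrier P)" and U: "subgroup U (AutF Q)"
  shows "subgroup (transport Q \<alpha> ` U) (AutF (\<alpha> ` Q))" and "card (transport Q \<alpha> ` U) = card U"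
proof -
  define Q' where "Q' = \<alpha> ` Q"
  have Q': "subgroup Q' P" unfolding Q'_def by (rule Hom_image_subgroup[OF Q \<alpha>])
  have tA: "transport Q \<alpha> u \<in> Hom Q' Q'" if "u \<in> Hom Q Q" for u
    unfolding Q'_def using transport_Aut[OF Q \<alpha> that] .
  have "transport Q \<alpha> \<in> hom (AutF Q) (AutF Q')"
  proof (rule homI)
    fix u assume "u \<in> carrier (AutF Q)"
    then show "transport Q \<alpha> u \<in> carrier (AutF Q')" using tA by (simp add: carrier_AutF)
  next
    fix u v assume "u \<in> carrier (AutF Q)" "v \<in> carrier (AutF Q)"
    then have uv: "u \<in> Hom Q Q" "v \<in> Hom Q Q" by (auto simp: carrier_AutF)
    have "transport Q \<alpha> (compose Q u v) = compose Q' (transport Q \<alpha> u) (transport Q \<alpha> v)"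
    proof
      fix z show "transport Q \<alpha> (compose Q u v) z = compose Q' (transport Q \<alpha> u) (transport Q \<alpha> v) z"
      proof (cases "z \<in> Q'")
        case True
        then obtain w where "w \<in> Q" "z = \<alpha> w" by (auto simp: Q'_def)
        then show ?thesis
          using True Aut_closed[OF Q uv(2)] by (simp add: transport_apply[OF Q \<alpha>] compose_def)
      qed (simp add: transport_def compose_def Q'_def)
    qed
    then show "transport Q \<alpha> (u \<otimes>\<^bsub>AutF Q\<^esub> v) = transport Q \<alpha> u \<otimes>\<^bsub>AutF Q'\<^esub> transport Q \<alpha> v"
      using uv tA by (simp add: AutF_mult[OF Q] AutF_mult[OF Q'])
  qed
  then have "group_hom (AutF Q) (AutF Q') (transport Q \<alpha>)"
    using group_AutF[OF Q] group_AutF[OF Q'] by (simp add: group_hom_def group_hom_axioms_def)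
  then show "subgroup (transport Q \<alpha> ` U) (AutF (\<alpha> ` Q))"
    using group_hom.subgroup_img_is_subgroup U unfolding Q'_def by blast
  have "inj_on (transport Q \<alpha>) U"
  proof (rule inj_onI)
    fix u v assume uv: "u \<in> U" "v \<in> U" and eq: "transport Q \<alpha> u = transport Q \<alpha> v"
    have uv': "u \<in> Hom Q Q" "v \<in> Hom Q Q" using uv subgroup.subset[OF U] by (auto simp: carrier_AutF)
    show "u = v"
    proof (rule AutF_eqI[OF Q uv'])
      fix z assume z: "z \<in> Q"
      have "\<alpha> (u z) = \<alpha> (v z)" using eq transport_apply[OF Q \<alpha> z] by metis
      then show "u z = v z"
        using Hom_inj[OF Q \<alpha>] Aut_closed[OF Q _ z] uv' by (meson inj_onD)
    qed
  qed
  then show "card (transport Q \<alpha> ` U) = card U" by (rule card_image)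
qed


section \<open>The Sylow property of fully normalized subgroups\<close>

lemma normalizer_in_carrier: "normalizer_in P (carrier P) = carrier P"
  using normalizer_in_alt[OF subset_refl finite_P] by auto

text \<open>Carry the p-group \<open>U\<close> over to the image of \<open>\<alpha>\<close>,
  conjugate it there into the Sylow subgroup Aut_P, and absorb the conjugating automorphism into
  \<open>\<alpha>\<close>. Under the new isomorphism \<open>\<tau>\<close>, every element of
  \<open>U\<close> becomes conjugation by an element of \<open>P\<close>.\<close>

lemma conj_into_AutP:
  assumes R: "subgroup R P" and \<alpha>: "\<alpha> \<in> Hom R (carrier P)"
    and sylow: "card (Hom (\<alpha> ` R) (\<alpha> ` R)) = card (AutP (\<alpha> ` R)) * m" "\<not> p dvd m"
    and U: "subgroup U (AutF R)" and cU: "card U = p ^ k"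
  shows "\<exists>\<tau> \<in> Hom R (carrier P). \<tau> ` R = \<alpha> ` R \<and>
    (\<forall>u \<in> U. \<exists>y \<in> normalizer_in P (\<alpha> ` R). \<forall>z \<in> R. \<tau> (u z) = y \<otimes> \<tau> z \<otimes> inv y)"
proof -
  define Q where "Q = \<alpha> ` R"
  have Q: "subgroup Q P" unfolding Q_def by (rule Hom_image_subgroup[OF R \<alpha>])
  interpret A: group "AutF Q" by (rule group_AutF[OF Q])
  have tU: "subgroup (transport R \<alpha> ` U) (AutF Q)" "card (transport R \<alpha> ` U) = p ^ k"
    using transport_subgroup[OF R \<alpha> U] cU by (auto simp: Q_def)
  obtain g where g: "g \<in> carrier (AutF Q)"
    and gU: "\<forall>u \<in> transport R \<alpha> ` U. g \<otimes>\<^bsub>AutF Q\<^esub> u \<otimes>\<^bsub>AutF Q\<^esub> inv\<^bsub>AutF Q\<^esub> g \<in> AutP Q"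
    using A.sylow_conjugation[OF prime_p finite_AutF[OF Q] AutP_subgroup[OF Q] tU, of m]
      sylow by (auto simp: Q_def carrier_AutF)
  have gQ: "g \<in> Hom Q Q" "g \<in> Hom Q (carrier P)" "g ` Q = Q"
    using g Aut_iff[OF Q] by (auto simp: carrier_AutF)
  define \<tau> where "\<tau> = compose R g \<alpha>"
  have \<tau>: "\<tau> \<in> Hom R (carrier P)"
    unfolding \<tau>_def by (rule Hom_comp[OF R \<alpha> Q _ gQ(2)]) (simp add: Q_def)
  have \<tau>_apply: "\<tau> z = g (\<alpha> z)" if "z \<in> R" for z using that by (simp add: \<tau>_def compose_def)
  have "\<tau> ` R = g ` \<alpha> ` R" unfolding image_image by (rule image_cong[OF refl]) (rule \<tau>_apply)
  then have \<tau>R: "\<tau> ` R = Q" using gQ(3) by (simp add: Q_def)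
  moreover have "\<exists>y \<in> normalizer_in P Q. \<forall>z \<in> R. \<tau> (u z) = y \<otimes> \<tau> z \<otimes> inv y" if u: "u \<in> U" for u
  proof -
    define t where "t = transport R \<alpha> u"
    define h where "h = g \<otimes>\<^bsub>AutF Q\<^esub> t \<otimes>\<^bsub>AutF Q\<^esub> inv\<^bsub>AutF Q\<^esub> g"
    have uR: "u \<in> Hom R R" using u subgroup.subset[OF U] by (auto simp: carrier_AutF)
    have tQ: "t \<in> Hom Q Q" unfolding t_def Q_def by (rule transport_Aut[OF R \<alpha> uR])
    have h: "h \<in> AutP Q" using gU u by (auto simp: h_def t_def)
    then have hQ: "h \<in> Hom Q Q" using subgroup.subset[OF AutP_subgroup[OF Q]] by (auto simp: carrier_AutF)
    obtain y where y: "y \<in> normalizer_in P Q" "\<forall>z \<in> Q. h z = y \<otimes> z \<otimes> inv y"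
      using h mem_AutP_iff[OF Q hQ] by blast
    have gt: "\<forall>z \<in> Q. g (t z) = h (g z)" using AutF_conj_iff[OF Q gQ(1) tQ hQ] h_def by blast
    have "\<tau> (u z) = y \<otimes> \<tau> z \<otimes> inv y" if z: "z \<in> R" for z
    proof -
      have "\<tau> (u z) = g (\<alpha> (u z))" by (rule \<tau>_apply[OF Aut_closed[OF R uR z]])
      also have "\<dots> = g (t (\<alpha> z))" unfolding t_def by (simp only: transport_apply[OF R \<alpha> z])
      also have "\<dots> = h (\<tau> z)" using gt z \<tau>_apply[OF z] by (simp add: Q_def)
      also have "\<dots> = y \<otimes> \<tau> z \<otimes> inv y" using y(2) z \<tau>R by blast
      finally show ?thesis .
    qed
    then show ?thesis using y(1) by blast
  qed
  ultimately show ?thesis using \<tau> unfolding Q_def by blast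
qed

lemma normalizer_ne:
  assumes "subgroup R P" "R \<noteq> carrier P"
  shows "\<exists>x \<in> normalizer_in P R - R. x [^] p \<in> R"
  using normalizer_in_grows_p_group[OF prime_p finite_P _ assms] p_group_P by blast

text \<open>Downward induction on the order of \<open>Q\<close>. If Aut_P(Q) were not Sylow, a
  p-element \<open>\<phi>\<close> outside it would normalize it, hence extend to the strictly larger
  group \<open>N = N_P(Q)\<close>. The extension can be taken of p-power order, so the Sylow
  property for a fully normalized image of \<open>N\<close> realizes it inside \<open>P\<close>;
  maximality of the order of \<open>N\<close> then forces the realizing element to come from
  \<open>N\<close>, and \<open>\<phi>\<close> lies in Aut_P(Q) after all.\<close>

lemma fully_normalized_sylow:
  assumes "fully_normalized P Hom Q"
  shows "\<exists>m. card (Hom Q Q) = card (AutP Q) * m \<and> \<not> p dvd m"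
  using assms
proof (induction "card (carrier P) - card Q" arbitrary: Q rule: less_induct)
  case less
  note fn = less.prems
  have Q: "subgroup Q P" using fn by (simp add: fully_normalized_def)
  show ?case
  proof (cases "Q = carrier P")
    case True
    have "AutP (carrier P) = (\<lambda>x. conjmap P x (carrier P)) ` carrier P"
      by (simp add: AutP_def normalizer_in_carrier)
    then show ?thesis
      using saturated[unfolded saturated_fusion_system_def, THEN conjunct2, THEN conjunct2, THEN conjunct1]
      unfolding True by metis
  next
    case False
    interpret A: group "AutF Q" by (rule group_AutF[OF Q])
    define N where "N = normalizer_in P Q"
    have N: "subgroup N P" unfolding N_def by (rule normalizer_subgroup[OF Q])
    have QN: "Q \<subseteq> N" unfolding N_def by (rule subset_normalizer_in[OF Q finite_P])
    have "N \<noteq> Q" using normalizer_ne[OF Q False] by (auto simp: N_def)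
    then have cQN: "card Q < card N" using QN finite_subgroup[OF N] by (intro psubset_card_mono) auto
    have NG: "z \<in> carrier P" if "z \<in> N" for z using that subgroup.subset[OF N] by blast
    interpret AN: group "AutF N" by (rule group_AutF[OF N])
    define idx where "idx = card (rcosets\<^bsub>AutF Q\<^esub> (AutP Q))"
    have idx: "card (carrier (AutF Q)) = card (AutP Q) * idx"
      using A.lagrange[OF AutP_subgroup[OF Q]] by (simp add: idx_def order_def mult.commute)
    have "\<not> p dvd idx"
    proof
      assume "p dvd idx"
      moreover obtain k where "card (AutP Q) = p ^ k" using card_AutP_p_power[OF Q] by blast
      ultimately obtain \<phi> j where \<phi>N: "\<phi> \<in> normalizer_in (AutF Q) (AutP Q)" and \<phi>S: "\<phi> \<notin> AutP Q"
        and \<phi>j: "\<phi> [^]\<^bsub>AutF Q\<^esub> (p ^ j) = \<one>\<^bsub>AutF Q\<^esub>"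
        using A.normalizer_in_grows[OF prime_p finite_AutF[OF Q] AutP_subgroup[OF Q] _ idx] by blast
      have \<phi>: "\<phi> \<in> Hom Q Q" using \<phi>N by (simp add: normalizer_in_def carrier_AutF)
      then have \<phi>': "\<phi> \<in> Hom Q (carrier P)" "\<phi> ` Q = Q" by (auto simp: Aut_iff[OF Q])
      \<comment> \<open>Since \<open>\<phi>\<close> normalizes Aut_P(Q), it conjugates the
        automorphism induced by x to one induced by some y, which is the witness for x.\<close>
      have "N \<subseteq> N_phi P Q \<phi>"
      proof
        fix x assume x: "x \<in> N"
        define c where "c = conjmap P x Q"
        have c: "c \<in> AutP Q" using x by (simp add: c_def AutP_def N_def)
        define h where "h = \<phi> \<otimes>\<^bsub>AutF Q\<^esub> c \<otimes>\<^bsub>AutF Q\<^esub> inv\<^bsub>AutF Q\<^esub> \<phi>"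
        have h: "h \<in> AutP Q" unfolding h_def using \<phi>N c by (auto simp: normalizer_in_def)
        have hc: "h \<in> Hom Q Q" "c \<in> Hom Q Q"
          using h c subgroup.subset[OF AutP_subgroup[OF Q]] by (auto simp: carrier_AutF)
        obtain y where y: "y \<in> normalizer_in P Q" "\<forall>z \<in> Q. h z = y \<otimes> z \<otimes> inv y"
          using h mem_AutP_iff[OF Q hc(1)] by blast
        have "\<forall>z \<in> Q. \<phi> (c z) = h (\<phi> z)" using AutF_conj_iff[OF Q \<phi> hc(2,1)] h_def by blast
        then have "\<forall>z \<in> Q. \<phi> (x \<otimes> z \<otimes> inv x) = y \<otimes> \<phi> z \<otimes> inv y"
          using y(2) Aut_closed[OF Q \<phi>] by (simp add: c_def conjmap_def)
        then show "x \<in> N_phi P Q \<phi>" using x y(1) \<phi>'(2) unfolding N_phi_def N_def by auto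
      qed
      then have "N_phi P Q \<phi> = N" by (auto simp: N_phi_def N_def)
      then obtain \<psi> where \<psi>: "\<psi> \<in> Hom N (carrier P)" and \<psi>Q: "\<forall>z \<in> Q. \<psi> z = \<phi> z"
        using extension[OF Q \<phi>'(1)] fn \<phi>'(2) by metis
      have "\<psi> ` N \<subseteq> N"
      proof
        fix x assume "x \<in> \<psi> ` N"
        then obtain n where n: "n \<in> N" "x = \<psi> n" by blast
        show "x \<in> N" unfolding N_def
        proof (rule normalizer_inI[OF Q])
          show "x \<in> carrier P" using Hom_closed[OF N \<psi>] n by simp
          fix z assume "z \<in> Q"
          then obtain w where w: "w \<in> Q" "z = \<phi> w" using \<phi>'(2) by blast
          then have "x \<otimes> z \<otimes> inv x = \<psi> (n \<otimes> w \<otimes> inv n)"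
            using Hom_conj[OF N \<psi> n(1)] QN n(2) \<psi>Q by auto
          moreover have nw: "n \<otimes> w \<otimes> inv n \<in> Q" using n(1) w(1) normalizer_in_conj by (simp add: N_def)
          ultimately show "x \<otimes> z \<otimes> inv x \<in> Q" using \<psi>Q Aut_closed[OF Q \<phi> nw] by simp
        qed
      qed
      then have \<psi>N: "\<psi> \<in> Hom N N" using \<psi> Hom_iff[OF N N] by blast
      have "\<phi> \<noteq> \<one>\<^bsub>AutF Q\<^esub>" using \<phi>S subgroup.one_closed[OF AutP_subgroup[OF Q]] by auto
      \<comment> \<open>\<open>coprime_bezout_strong\<close> excludes the modulus 1.\<close>
      then have pj: "p ^ j \<noteq> 1" using \<phi>j \<phi> by (auto simp: carrier_AutF)
      obtain a r where ar: "AN.ord \<psi> = p ^ a * r" "\<not> p dvd r"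
      proof -
        have "AN.ord \<psi> \<noteq> 0" using AN.ord_ge_1[OF finite_AutF[OF N], of \<psi>] \<psi>N
          by (simp add: carrier_AutF)
        moreover have "\<not> is_unit p" using prime_p not_prime_unit by blast
        ultimately obtain r where "AN.ord \<psi> = p ^ multiplicity p (AN.ord \<psi>) * r" "\<not> p dvd r"
          using multiplicity_decompose'[of "AN.ord \<psi>" p] by blast
        then show ?thesis using that by blast
      qed
      have "coprime r (p ^ j)"
        using prime_imp_coprime[OF prime_p ar(2)] by (simp add: coprime_commute)
      \<comment> \<open>The exponent r t is divisible by the part of the order of
        \<open>\<psi>\<close> prime to \<open>p\<close>, so the power \<open>\<chi>\<close> has
        p-power order; it is 1 modulo p^j, so on \<open>Q\<close> the power still agrees with
        \<open>\<phi>\<close>.\<close>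
      then obtain t s where ts: "r * t = p ^ j * s + 1"
        using coprime_bezout_strong[of r "p ^ j"] pj by blast
      define \<chi> where "\<chi> = \<psi> [^]\<^bsub>AutF N\<^esub> (r * t)"
      have \<chi>A: "\<chi> \<in> carrier (AutF N)" unfolding \<chi>_def using \<psi>N by (simp add: carrier_AutF[symmetric])
      have \<chi>Q: "\<chi> z = \<phi> z" if z: "z \<in> Q" for z
      proof -
        have fp: "(\<psi> ^^ e) z = (\<phi> ^^ e) z \<and> (\<phi> ^^ e) z \<in> Q" for e
          by (induction e) (use z \<psi>Q Aut_closed[OF Q \<phi>] in auto)
        have "\<chi> z = (\<psi> ^^ (r * t)) z" unfolding \<chi>_def using AutF_pow[OF N \<psi>N] z QN by blast
        also have "\<dots> = (\<phi> ^^ (r * t)) z" using fp by blast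
        also have "\<dots> = (\<phi> [^]\<^bsub>AutF Q\<^esub> (r * t)) z" using AutF_pow[OF Q \<phi>] z by simp
        also have "\<phi> [^]\<^bsub>AutF Q\<^esub> (r * t) = \<phi>"
        proof -
          have \<phi>A: "\<phi> \<in> carrier (AutF Q)" using \<phi> by (simp add: carrier_AutF)
          have "\<phi> [^]\<^bsub>AutF Q\<^esub> (p ^ j * s) = \<one>\<^bsub>AutF Q\<^esub>"
            using A.nat_pow_pow[OF \<phi>A, of "p ^ j" s] \<phi>j by simp
          then show ?thesis unfolding ts using A.nat_pow_mult[OF \<phi>A, of "p ^ j * s" 1] \<phi>A by simp
        qed
        finally show ?thesis .
      qed
      have "\<chi> [^]\<^bsub>AutF N\<^esub> (p ^ a) = \<one>\<^bsub>AutF N\<^esub>"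
      proof -
        have "\<chi> [^]\<^bsub>AutF N\<^esub> (p ^ a) = \<psi> [^]\<^bsub>AutF N\<^esub> (AN.ord \<psi> * t)"
          unfolding \<chi>_def ar(1) using \<psi>N by (simp add: AN.nat_pow_pow carrier_AutF ac_simps)
        then show ?thesis
          using \<psi>N AN.pow_eq_id[of \<psi> "AN.ord \<psi> * t"] by (simp add: carrier_AutF)
      qed
      then have "AN.ord \<chi> dvd p ^ a" using AN.pow_eq_id[OF \<chi>A] by blast
      then obtain i where i: "AN.ord \<chi> = p ^ i" using divides_primepow_nat[OF prime_p] by blast
      define U where "U = generate (AutF N) {\<chi>}"
      have U: "subgroup U (AutF N)" "card U = p ^ i" "\<chi> \<in> U"
        using AN.generate_is_subgroup[of "{\<chi>}"] AN.generate_pow_card[OF \<chi>A] i \<chi>A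
        by (auto simp: U_def intro: generate.incl)
      obtain \<alpha> where \<alpha>: "\<alpha> \<in> Hom N (carrier P)" "fully_normalized P Hom (\<alpha> ` N)"
        using exists_fully_normalized[OF N] by blast
      have "card Q < card (\<alpha> ` N)" using cQN Hom_card_image[OF N \<alpha>(1)] by simp
      moreover have "card N \<le> card (carrier P)" using finite_P NG by (intro card_mono) auto
      ultimately have "card (carrier P) - card (\<alpha> ` N) < card (carrier P) - card Q"
        using Hom_card_image[OF N \<alpha>(1)] by simp
      from less.hyps[OF this \<alpha>(2)] obtain m where
        m: "card (Hom (\<alpha> ` N) (\<alpha> ` N)) = card (AutP (\<alpha> ` N)) * m" "\<not> p dvd m" by blast
      obtain \<tau> y where \<tau>: "\<tau> \<in> Hom N (carrier P)" "\<tau> ` N = \<alpha> ` N"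
        and y: "y \<in> normalizer_in P (\<alpha> ` N)" and \<tau>\<chi>: "\<forall>z \<in> N. \<tau> (\<chi> z) = y \<otimes> \<tau> z \<otimes> inv y"
        using conj_into_AutP[OF N \<alpha>(1) m U(1,2)] U(3) by blast
      define R where "R = \<tau> ` Q"
      have \<tau>Q: "restrict \<tau> Q \<in> Hom Q (carrier P)" by (rule Hom_restrict[OF N \<tau>(1) Q QN])
      have R: "subgroup R P" using Hom_image_subgroup[OF Q \<tau>Q] by (simp add: R_def)
      have "fusion_iso Hom Q R (restrict \<tau> Q)"
        using \<tau>Q Hom_iff[OF Q R, of "restrict \<tau> Q"] by (simp add: fusion_iso_def R_def)
      then have "card (normalizer_in P R) \<le> card N"
        using fn R unfolding fully_normalized_def N_def by blast
      moreover have sub: "\<tau> ` N \<subseteq> normalizer_in P R"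
      proof
        fix x assume "x \<in> \<tau> ` N"
        then obtain n where n: "n \<in> N" "x = \<tau> n" by blast
        show "x \<in> normalizer_in P R"
        proof (rule normalizer_inI[OF R])
          show "x \<in> carrier P" using Hom_closed[OF N \<tau>(1)] n by simp
          fix z assume "z \<in> R"
          then obtain w where w: "w \<in> Q" "z = \<tau> w" by (auto simp: R_def)
          then have "x \<otimes> z \<otimes> inv x = \<tau> (n \<otimes> w \<otimes> inv n)"
            using Hom_conj[OF N \<tau>(1) n(1)] QN n(2) by auto
          moreover have "n \<otimes> w \<otimes> inv n \<in> Q" using n(1) w(1) normalizer_in_conj by (simp add: N_def)
          ultimately show "x \<otimes> z \<otimes> inv x \<in> R" by (simp add: R_def)
        qed
      qed
      moreover have "card (\<tau> ` N) = card N" by (rule Hom_card_image[OF N \<tau>(1)])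
      ultimately have \<tau>N: "\<tau> ` N = normalizer_in P R"
        using finite_subgroup[OF normalizer_subgroup[OF R]] by (intro card_seteq) auto
      have "y \<in> normalizer_in P R"
      proof (rule normalizer_inI[OF R])
        show "y \<in> carrier P" using y by (simp add: normalizer_in_def)
        fix z assume "z \<in> R"
        then obtain w where w: "w \<in> Q" "z = \<tau> w" by (auto simp: R_def)
        have "\<tau> (\<chi> w) = y \<otimes> \<tau> w \<otimes> inv y" using \<tau>\<chi> w(1) QN by blast
        then have "y \<otimes> z \<otimes> inv y = \<tau> (\<phi> w)" using w \<chi>Q by simp
        then show "y \<otimes> z \<otimes> inv y \<in> R" using Aut_closed[OF Q \<phi> w(1)] by (simp add: R_def)
      qed
      then obtain n where n: "n \<in> N" "y = \<tau> n" using \<tau>N by blast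
      \<comment> \<open>Pulled back along the injective \<open>\<tau>\<close>, the identity shows
        that \<open>\<phi>\<close> is conjugation by n.\<close>
      have "\<phi> z = n \<otimes> z \<otimes> inv n" if z: "z \<in> Q" for z
      proof (rule inj_onD[OF Hom_inj[OF N \<tau>(1)]])
        have zN: "z \<in> N" using z QN by blast
        have "\<tau> (\<chi> z) = y \<otimes> \<tau> z \<otimes> inv y" using \<tau>\<chi> zN by blast
        then have "\<tau> (\<phi> z) = y \<otimes> \<tau> z \<otimes> inv y" using \<chi>Q[OF z] by simp
        then show "\<tau> (\<phi> z) = \<tau> (n \<otimes> z \<otimes> inv n)" using Hom_conj[OF N \<tau>(1) n(1) zN] n(2) by simp
        show "\<phi> z \<in> N" using Aut_closed[OF Q \<phi> z] QN by blast
        have "n \<otimes> z \<otimes> inv n \<in> Q" using n(1) z normalizer_in_conj by (simp add: N_def)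
        then show "n \<otimes> z \<otimes> inv n \<in> N" using QN by blast
      qed
      then have "\<phi> \<in> AutP Q" using mem_AutP_iff[OF Q \<phi>] n(1) unfolding N_def by blast
      then show False using \<phi>S by blast
    qed
    then show ?thesis using idx by (auto simp: carrier_AutF)
  qed
qed

end

section \<open>Normal subgroups of fusion systems\<close>

lemma restrict_image_subset: "B \<subseteq> A \<Longrightarrow> restrict f A ` B = f ` B"
  by (rule image_cong) auto

lemma (in group) grp_center_subgroup: "subgroup (grp_center G) G"
proof (rule subgroupI)
  have "\<one> \<in> grp_center G" by (simp add: grp_center_def)
  then show "grp_center G \<noteq> {}" by blast
next
  fix a assume a: "a \<in> grp_center G"
  then have aG: "a \<in> carrier G" by (simp add: grp_center_def)
  have "inv a \<otimes> x = x \<otimes> inv a" if x: "x \<in> carrier G" for x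
  proof -
    have "inv a \<otimes> x = inv a \<otimes> (x \<otimes> a) \<otimes> inv a" using aG x by (simp add: m_assoc)
    also have "x \<otimes> a = a \<otimes> x" using a x unfolding grp_center_def by auto
    finally show ?thesis using aG x by (simp add: inv_mult_cancel_left)
  qed
  then show "inv a \<in> grp_center G" using inv_closed[OF aG] unfolding grp_center_def by blast
next
  fix a b assume a: "a \<in> grp_center G" and b: "b \<in> grp_center G"
  have "a \<otimes> b \<otimes> x = x \<otimes> (a \<otimes> b)" if x: "x \<in> carrier G" for x
  proof -
    have ab: "a \<in> carrier G" "b \<in> carrier G" and ax: "a \<otimes> x = x \<otimes> a" and bx: "b \<otimes> x = x \<otimes> b"
      using a b x unfolding grp_center_def by blast+
    have "a \<otimes> b \<otimes> x = a \<otimes> x \<otimes> b" using ab x by (simp add: m_assoc bx)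
    then show ?thesis using ab x by (simp only: ax m_assoc)
  qed
  then show "a \<otimes> b \<in> grp_center G" using a b m_closed unfolding grp_center_def by blast
qed (auto simp: grp_center_def)

lemma (in group) normal_of_normalizer_in:
  assumes "subgroup W G" "normalizer_in G W = carrier G"
  shows "W \<lhd> G"
  using assms by (auto simp: normal_inv_iff normalizer_in_def)

context saturated_fusion
begin

text \<open>The condition for normality of \<open>W\<close> at one morphism, with codomain
  \<open>P\<close>. Only the values of \<open>\<phi>\<close> on \<open>R\<close> enter, so it
  applies to unrestricted lambda terms and to \<open>inv_into\<close> without making them
  extensional.\<close>

definition extends_over :: "'a set \<Rightarrow> 'a set \<Rightarrow> ('a \<Rightarrow> 'a) \<Rightarrow> bool" where
  "extends_over W R \<phi> \<longleftrightarrow> (\<exists>\<psi> \<in> Hom (W <#> R) (carrier P). (\<forall>z \<in> R. \<psi> z = \<phi> z) \<and> \<psi> ` W = W)"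

context
  fixes W
  assumes W: "W \<lhd> P"
begin

lemma W_subgroup: "subgroup W P"
  using W by (rule normal_imp_subgroup)

lemma prod_subgroup: "subgroup R P \<Longrightarrow> subgroup (W <#> R) P"
  by (rule mult_norm_subgroup[OF W])

lemma subset_prod:
  assumes "subgroup R P"
  shows "R \<subseteq> W <#> R" and "W \<subseteq> W <#> R"
proof -
  show "R \<subseteq> W <#> R"
  proof
    fix r assume r: "r \<in> R"
    then have "\<one> \<otimes> r = r" using subgroup.subset[OF assms] by auto
    then show "r \<in> W <#> R" using r subgroup.one_closed[OF W_subgroup] unfolding set_mult_def by blast
  qed
  show "W \<subseteq> W <#> R"
  proof
    fix w assume w: "w \<in> W"
    then have "w \<otimes> \<one> = w" using subgroup.subset[OF W_subgroup] by auto
    then show "w \<in> W <#> R" using w subgroup.one_closed[OF assms] unfolding set_mult_def by blast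
  qed
qed

lemma prod_absorb:
  assumes R: "subgroup R P" and "W \<subseteq> R"
  shows "W <#> R = R"
proof
  show "W <#> R \<subseteq> R" using assms(2) subgroup.m_closed[OF R] by (auto simp: set_mult_def)
qed (rule subset_prod(1)[OF R])

lemma Hom_image_prod:
  assumes R: "subgroup R P" and \<psi>: "\<psi> \<in> Hom (W <#> R) (carrier P)"
  shows "\<psi> ` (W <#> R) = \<psi> ` W <#> \<psi> ` R"
proof -
  have "\<psi> (w \<otimes> r) = \<psi> w \<otimes> \<psi> r" if "w \<in> W" "r \<in> R" for w r
    using Hom_mult[OF prod_subgroup[OF R] \<psi>] subset_prod[OF R] that by blast
  then show ?thesis unfolding set_mult_def by (auto simp: image_UN)
qed

lemma extends_over_self:
  assumes "subgroup R P" "W \<subseteq> R" "\<phi> \<in> Hom R (carrier P)" "\<phi> ` W = W"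
  shows "extends_over W R \<phi>"
  unfolding extends_over_def prod_absorb[OF assms(1,2)] using assms by blast

lemma extends_over_cong:
  assumes "extends_over W R \<phi>" "\<And>z. z \<in> R \<Longrightarrow> \<phi> z = \<phi>' z"
  shows "extends_over W R \<phi>'"
  using assms unfolding extends_over_def by metis

lemma extends_over_restrict:
  assumes R: "subgroup R P" and T: "subgroup T P" "R \<subseteq> T" and \<psi>: "extends_over W T \<psi>"
    and eq: "\<And>z. z \<in> R \<Longrightarrow> \<psi> z = \<phi> z"
  shows "extends_over W R \<phi>"
proof -
  obtain \<xi> where \<xi>: "\<xi> \<in> Hom (W <#> T) (carrier P)" "\<forall>z \<in> T. \<xi> z = \<psi> z" "\<xi> ` W = W"
    using \<psi> by (auto simp: extends_over_def)
  have sub: "W <#> R \<subseteq> W <#> T" using T(2) by (auto simp: set_mult_def)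
  have "restrict \<xi> (W <#> R) \<in> Hom (W <#> R) (carrier P)"
    by (rule Hom_restrict[OF prod_subgroup[OF T(1)] \<xi>(1) prod_subgroup[OF R] sub])
  moreover have "\<forall>z \<in> R. restrict \<xi> (W <#> R) z = \<phi> z"
    using subset_prod(1)[OF R] \<xi>(2) T(2) eq by auto
  moreover have "restrict \<xi> (W <#> R) ` W = W"
    using restrict_image_subset[OF subset_prod(2)[OF R], of \<xi>] \<xi>(3) by simp
  ultimately show ?thesis unfolding extends_over_def by blast
qed

lemma extends_over_comp:
  assumes R: "subgroup R P" and \<phi>: "extends_over W R \<phi>"
    and R': "subgroup (\<phi> ` R) P" and \<chi>: "extends_over W (\<phi> ` R) \<chi>"
  shows "extends_over W R (\<lambda>z. \<chi> (\<phi> z))"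
proof -
  obtain \<xi> where \<xi>: "\<xi> \<in> Hom (W <#> R) (carrier P)" "\<forall>z \<in> R. \<xi> z = \<phi> z" "\<xi> ` W = W"
    using \<phi> by (auto simp: extends_over_def)
  obtain \<zeta> where \<zeta>: "\<zeta> \<in> Hom (W <#> \<phi> ` R) (carrier P)" "\<forall>z \<in> \<phi> ` R. \<zeta> z = \<chi> z" "\<zeta> ` W = W"
    using \<chi> by (auto simp: extends_over_def)
  have "\<xi> ` R = \<phi> ` R" using \<xi>(2) by (intro image_cong) auto
  then have im: "\<xi> ` (W <#> R) = W <#> \<phi> ` R" using Hom_image_prod[OF R \<xi>(1)] \<xi>(3) by simp
  have "compose (W <#> R) \<zeta> \<xi> \<in> Hom (W <#> R) (carrier P)"
    by (rule Hom_comp[OF prod_subgroup[OF R] \<xi>(1) prod_subgroup[OF R'] _ \<zeta>(1)]) (simp add: im)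
  moreover have "\<forall>z \<in> R. compose (W <#> R) \<zeta> \<xi> z = \<chi> (\<phi> z)"
    using subset_prod(1)[OF R] \<xi>(2) \<zeta>(2) by (auto simp: compose_def)
  moreover have "compose (W <#> R) \<zeta> \<xi> ` W = W"
  proof -
    have "compose (W <#> R) \<zeta> \<xi> ` W = \<zeta> ` \<xi> ` W"
      unfolding image_image using subset_prod(2)[OF R]
      by (intro image_cong[OF refl]) (auto simp: compose_def)
    then show ?thesis using \<xi>(3) \<zeta>(3) by simp
  qed
  ultimately show ?thesis unfolding extends_over_def by blast
qed

lemma extends_over_inverse:
  assumes R: "subgroup R P" and \<phi>: "\<phi> \<in> Hom R (carrier P)" and e: "extends_over W R \<phi>"
  shows "extends_over W (\<phi> ` R) (inv_into R \<phi>)"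
proof -
  obtain \<xi> where \<xi>: "\<xi> \<in> Hom (W <#> R) (carrier P)" "\<forall>z \<in> R. \<xi> z = \<phi> z" "\<xi> ` W = W"
    using e by (auto simp: extends_over_def)
  have WR: "subgroup (W <#> R) P" by (rule prod_subgroup[OF R])
  have inj: "inj_on \<xi> (W <#> R)" by (rule Hom_inj[OF WR \<xi>(1)])
  have "\<xi> ` R = \<phi> ` R" using \<xi>(2) by (intro image_cong) auto
  then have im: "\<xi> ` (W <#> R) = W <#> \<phi> ` R" using Hom_image_prod[OF R \<xi>(1)] \<xi>(3) by simp
  define \<zeta> where "\<zeta> = restrict (inv_into (W <#> R) \<xi>) (W <#> \<phi> ` R)"
  have "\<zeta> \<in> Hom (W <#> \<phi> ` R) (carrier P)"
    using Hom_inverse[OF WR \<xi>(1)] unfolding \<zeta>_def im .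
  moreover have z: "\<zeta> (\<xi> x) = x" if "x \<in> W <#> R" for x
    using that im inj by (auto simp: \<zeta>_def)
  have "\<forall>z \<in> \<phi> ` R. \<zeta> z = inv_into R \<phi> z"
  proof
    fix z assume "z \<in> \<phi> ` R"
    then obtain r where r: "r \<in> R" "z = \<phi> r" by blast
    then have "\<zeta> z = r" using z[of r] subset_prod(1)[OF R] \<xi>(2) by auto
    then show "\<zeta> z = inv_into R \<phi> z" using r Hom_inj[OF R \<phi>] by simp
  qed
  moreover have "\<zeta> ` W = W"
  proof -
    have "\<zeta> ` W = \<zeta> ` \<xi> ` W" using \<xi>(3) by simp
    also have "\<dots> = (\<lambda>x. x) ` W"
      unfolding image_image using subset_prod(2)[OF R] by (intro image_cong[OF refl] z) auto
    finally show ?thesis by simp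
  qed
  ultimately show ?thesis unfolding extends_over_def by blast
qed

text \<open>A form of Alperin's fusion theorem: it suffices to treat automorphisms of centric subgroups,
  and those only up to composition with automorphisms stabilizing \<open>W\<close>.\<close>

lemma extends_over_all:
  assumes WZ: "W \<subseteq> grp_center P"
    and top: "\<And>f. f \<in> Hom (carrier P) (carrier P) \<Longrightarrow> f ` W = W"
    and centric: "\<And>Q \<chi>. subgroup Q P \<Longrightarrow> Q \<noteq> carrier P \<Longrightarrow> fully_normalized P Hom Q \<Longrightarrow>
      {c \<in> carrier P. \<forall>z \<in> Q. c \<otimes> z = z \<otimes> c} \<subseteq> Q \<Longrightarrow> \<chi> \<in> Hom Q Q \<Longrightarrow>
      \<exists>\<kappa> \<in> Hom Q Q. \<kappa> ` W = W \<and> N_phi P Q (compose Q \<kappa> \<chi>) \<noteq> Q"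
    and R: "subgroup R P" and \<phi>: "\<phi> \<in> Hom R (carrier P)"
  shows "extends_over W R \<phi>"
  using R \<phi>
proof (induction "card (carrier P) - card R" arbitrary: R \<phi> rule: less_induct)
  case less
  note R = less.prems(1) and \<phi> = less.prems(2)
  show ?case
  proof (cases "R = carrier P")
    case True
    then show ?thesis
      using extends_over_self[OF R _ \<phi>] top \<phi> subgroup.subset[OF W_subgroup] by simp
  next
    case False
    \<comment> \<open>If \<open>N_phi\<close> exceeds \<open>S\<close>, the extension axiom passes
      to a larger domain, where the induction hypothesis applies; its result is restricted back to
      \<open>S\<close>.\<close>
    have extend: "extends_over W S \<chi>"
      if S: "subgroup S P" and cS: "card S = card R" and \<chi>: "\<chi> \<in> Hom S (carrier P)"
        and fn: "fully_normalized P Hom (\<chi> ` S)" and ne: "N_phi P S \<chi> \<noteq> S" for S \<chi>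
    proof -
      define T where "T = N_phi P S \<chi>"
      have T: "subgroup T P" "S \<subseteq> T" using N_phi_subgroup[OF S \<chi>] by (auto simp: T_def)
      obtain \<psi> where \<psi>: "\<psi> \<in> Hom T (carrier P)" "\<forall>z \<in> S. \<psi> z = \<chi> z"
        using extension[OF S \<chi> fn] unfolding T_def by blast
      have "card S < card T" using T ne finite_subgroup[OF T(1)] by (intro psubset_card_mono) (auto simp: T_def)
      moreover have "card T \<le> card (carrier P)" using subgroup.subset[OF T(1)] finite_P by (rule card_mono[rotated])
      ultimately have "card (carrier P) - card T < card (carrier P) - card R" using cS by simp
      from less.hyps[OF this T(1) \<psi>(1)] show ?thesis
        by (rule extends_over_restrict[OF S T]) (use \<psi>(2) in auto)
    qed
    have neP: "S \<noteq> carrier P" if S: "subgroup S P" and cS: "card S = card R" for S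
      using False card_subset_eq[OF finite_P subgroup.subset[OF R]] cS by auto
    obtain \<alpha> where \<alpha>: "\<alpha> \<in> Hom R (carrier P)" "fully_normalized P Hom (\<alpha> ` R)"
      using exists_fully_normalized[OF R] by blast
    define Q where "Q = \<alpha> ` R"
    have Q: "subgroup Q P" unfolding Q_def by (rule Hom_image_subgroup[OF R \<alpha>(1)])
    have fnQ: "fully_normalized P Hom Q" using \<alpha>(2) by (simp add: Q_def)
    have cQ: "card Q = card R" unfolding Q_def by (rule Hom_card_image[OF R \<alpha>(1)])
    obtain m where m: "card (Hom Q Q) = card (AutP Q) * m" "\<not> p dvd m"
      using fully_normalized_sylow[OF fnQ] by blast
    \<comment> \<open>Among the isomorphisms from \<open>S\<close> to \<open>Q\<close>, choose one
      that carries Aut_P(S) into Aut_P(Q). Its \<open>N_phi\<close> contains the whole normalizer of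
      \<open>S\<close>, so \<open>extend\<close> applies. Any two subgroups isomorphic to
      \<open>Q\<close> are thus linked to it by morphisms already settled, which leaves the
      automorphisms of \<open>Q\<close>.\<close>
    have straighten: "\<exists>\<tau> \<in> Hom S (carrier P). \<tau> ` S = Q \<and> extends_over W S \<tau>"
      if S: "subgroup S P" and \<beta>: "\<beta> \<in> Hom S (carrier P)" "\<beta> ` S = Q" for S \<beta>
    proof -
      have cS: "card S = card R" using Hom_card_image[OF S \<beta>(1)] \<beta>(2) cQ by simp
      obtain k where k: "card (AutP S) = p ^ k" using card_AutP_p_power[OF S] by blast
      obtain \<tau> where \<tau>: "\<tau> \<in> Hom S (carrier P)" "\<tau> ` S = Q"
        and \<tau>u: "\<forall>u \<in> AutP S. \<exists>y \<in> normalizer_in P Q. \<forall>z \<in> S. \<tau> (u z) = y \<otimes> \<tau> z \<otimes> inv y"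
        using conj_into_AutP[OF S \<beta>(1) _ m(2) AutP_subgroup[OF S] k] m(1) \<beta>(2) by metis
      have "normalizer_in P S \<subseteq> N_phi P S \<tau>"
      proof
        fix x assume x: "x \<in> normalizer_in P S"
        then have "conjmap P x S \<in> AutP S" by (simp add: AutP_def)
        then obtain y where "y \<in> normalizer_in P Q"
          "\<forall>z \<in> S. \<tau> (conjmap P x S z) = y \<otimes> \<tau> z \<otimes> inv y" using \<tau>u by blast
        then show "x \<in> N_phi P S \<tau>" using x \<tau>(2) by (auto simp: N_phi_def conjmap_def)
      qed
      then have "N_phi P S \<tau> \<noteq> S" using normalizer_ne[OF S neP[OF S cS]] by auto
      then have "extends_over W S \<tau>" using extend[OF S cS \<tau>(1)] \<tau>(2) fnQ by simp
      then show ?thesis using \<tau> by blast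
    qed
    have automorphism: "extends_over W Q \<chi>" if \<chi>: "\<chi> \<in> Hom Q Q" for \<chi>
    proof -
      have \<chi>': "\<chi> \<in> Hom Q (carrier P)" "\<chi> ` Q = Q" using \<chi> by (auto simp: Aut_iff[OF Q])
      show ?thesis
      proof (cases "{c \<in> carrier P. \<forall>z \<in> Q. c \<otimes> z = z \<otimes> c} \<subseteq> Q")
        case False
        then obtain c where c: "c \<in> carrier P" "\<forall>z \<in> Q. c \<otimes> z = z \<otimes> c" "c \<notin> Q" by blast
        have cz: "c \<otimes> z \<otimes> inv c = z" if "z \<in> Q" for z
          using c that subgroup.subset[OF Q] by (auto simp: m_assoc)
        \<comment> \<open>\<open>c\<close> acts trivially on \<open>Q\<close>, so the unit is a
          witness that it lies in \<open>N_phi\<close>.\<close>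
        have "c \<in> normalizer_in P Q" by (rule normalizer_inI[OF Q c(1)]) (simp add: cz)
        moreover have "\<one> \<in> normalizer_in P Q"
          using subgroup.one_closed[OF normalizer_subgroup[OF Q]] .
        moreover have "\<forall>z \<in> Q. \<chi> (c \<otimes> z \<otimes> inv c) = \<one> \<otimes> \<chi> z \<otimes> inv \<one>"
          using cz Hom_closed[OF Q \<chi>'(1)] by simp
        ultimately have "c \<in> N_phi P Q \<chi>" unfolding N_phi_def \<chi>'(2) by blast
        then show ?thesis using extend[OF Q cQ \<chi>'(1)] fnQ \<chi>'(2) c(3) by auto
      next
        case True
        then obtain \<kappa> where \<kappa>: "\<kappa> \<in> Hom Q Q" "\<kappa> ` W = W" "N_phi P Q (compose Q \<kappa> \<chi>) \<noteq> Q"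
          using centric[OF Q neP[OF Q cQ] fnQ _ \<chi>] by blast
        have \<kappa>': "\<kappa> \<in> Hom Q (carrier P)" "\<kappa> ` Q = Q" using \<kappa>(1) by (auto simp: Aut_iff[OF Q])
        have \<theta>: "compose Q \<kappa> \<chi> \<in> Hom Q (carrier P)" "compose Q \<kappa> \<chi> ` Q = Q"
        proof -
          show "compose Q \<kappa> \<chi> \<in> Hom Q (carrier P)" by (rule Hom_comp[OF Q \<chi>'(1) Q _ \<kappa>'(1)]) (simp add: \<chi>'(2))
          have "compose Q \<kappa> \<chi> ` Q = \<kappa> ` \<chi> ` Q"
            unfolding image_image by (intro image_cong[OF refl]) (simp add: compose_def)
          then show "compose Q \<kappa> \<chi> ` Q = Q" using \<chi>'(2) \<kappa>'(2) by simp
        qed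
        \<comment> \<open>\<open>W\<close> is central and \<open>Q\<close> contains its centralizer,
          so \<open>\<kappa>\<close> extends trivially. Then \<open>\<chi>\<close> is the composite
          \<open>\<kappa> \<chi>\<close> followed by the inverse of \<open>\<kappa>\<close>, and
          both factors extend.\<close>
        have "W \<subseteq> Q" using WZ True subgroup.subset[OF Q] unfolding grp_center_def by blast
        then have "extends_over W Q \<kappa>" using extends_over_self[OF Q _ \<kappa>'(1) \<kappa>(2)] by blast
        then have "extends_over W Q (inv_into Q \<kappa>)"
          using extends_over_inverse[OF Q \<kappa>'(1)] \<kappa>'(2) by simp
        moreover have "extends_over W Q (compose Q \<kappa> \<chi>)"
          using extend[OF Q cQ \<theta>(1)] \<theta>(2) fnQ \<kappa>(3) by simp
        ultimately have "extends_over W Q (\<lambda>z. inv_into Q \<kappa> (compose Q \<kappa> \<chi> z))"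
          using extends_over_comp[OF Q, of "compose Q \<kappa> \<chi>" "inv_into Q \<kappa>"] \<theta>(2) Q by simp
        then show ?thesis
          by (rule extends_over_cong)
            (simp add: compose_def Hom_inj[OF Q \<kappa>'(1)] Aut_closed[OF Q \<chi>])
      qed
    qed
    define S where "S = \<phi> ` R"
    have S: "subgroup S P" unfolding S_def by (rule Hom_image_subgroup[OF R \<phi>])
    define \<gamma> where "\<gamma> = restrict (inv_into R \<phi>) S"
    have \<gamma>: "\<gamma> \<in> Hom S (carrier P)" "\<gamma> ` S = R"
      using Hom_inverse[OF R \<phi>] Hom_inj[OF R \<phi>] by (auto simp: \<gamma>_def S_def)
    have \<beta>: "compose S \<alpha> \<gamma> \<in> Hom S (carrier P)" "compose S \<alpha> \<gamma> ` S = Q"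
    proof -
      show "compose S \<alpha> \<gamma> \<in> Hom S (carrier P)" by (rule Hom_comp[OF S \<gamma>(1) R _ \<alpha>(1)]) (simp add: \<gamma>(2))
      have "compose S \<alpha> \<gamma> ` S = \<alpha> ` \<gamma> ` S"
        unfolding image_image by (intro image_cong[OF refl]) (simp add: compose_def)
      then show "compose S \<alpha> \<gamma> ` S = Q" using \<gamma>(2) by (simp add: Q_def)
    qed
    obtain \<tau> where \<tau>: "\<tau> \<in> Hom R (carrier P)" "\<tau> ` R = Q" "extends_over W R \<tau>"
      using straighten[OF R \<alpha>(1)] by (auto simp: Q_def)
    obtain \<sigma> where \<sigma>: "\<sigma> \<in> Hom S (carrier P)" "\<sigma> ` S = Q" "extends_over W S \<sigma>"
      using straighten[OF S \<beta>] by auto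
    define \<tau>' where "\<tau>' = restrict (inv_into R \<tau>) Q"
    have \<tau>': "\<tau>' \<in> Hom Q (carrier P)" "\<tau>' ` Q = R"
      using Hom_inverse[OF R \<tau>(1)] Hom_inj[OF R \<tau>(1)] \<tau>(2) by (auto simp: \<tau>'_def)
    \<comment> \<open>The automorphism of \<open>Q\<close> for which \<open>\<phi>\<close> is
      \<open>\<tau>\<close>, then \<open>\<chi>\<close>, then the inverse of
      \<open>\<sigma>\<close>; each of the three factors extends over \<open>W\<close>.\<close>
    define \<chi> where "\<chi> = compose Q (compose R \<sigma> \<phi>) \<tau>'"
    have \<sigma>\<phi>: "compose R \<sigma> \<phi> \<in> Hom R (carrier P)"
      by (rule Hom_comp[OF R \<phi> S _ \<sigma>(1)]) (simp add: S_def)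
    have \<chi>: "\<chi> \<in> Hom Q Q"
    proof -
      have "\<chi> \<in> Hom Q (carrier P)" unfolding \<chi>_def
        by (rule Hom_comp[OF Q \<tau>'(1) R _ \<sigma>\<phi>]) (simp add: \<tau>'(2))
      moreover have "\<chi> ` Q = Q"
      proof -
        have "\<chi> ` Q = \<sigma> ` \<phi> ` \<tau>' ` Q"
          unfolding image_image by (intro image_cong[OF refl]) (use \<tau>'(2) in \<open>auto simp: \<chi>_def compose_def\<close>)
        then show ?thesis using \<tau>'(2) \<sigma>(2) by (simp add: S_def)
      qed
      ultimately show ?thesis by (simp add: Aut_iff[OF Q])
    qed
    have "extends_over W R (\<lambda>z. \<chi> (\<tau> z))"
      using extends_over_comp[OF R \<tau>(3), of \<chi>] automorphism[OF \<chi>] \<tau>(2) Q by simp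
    moreover have im: "(\<lambda>z. \<chi> (\<tau> z)) ` R = Q"
      using Aut_image[OF Q \<chi>] \<tau>(2) by (simp flip: image_image)
    moreover have "extends_over W Q (inv_into S \<sigma>)"
      using extends_over_inverse[OF S \<sigma>(1,3)] \<sigma>(2) by simp
    ultimately have "extends_over W R (\<lambda>z. inv_into S \<sigma> (\<chi> (\<tau> z)))"
      using extends_over_comp[OF R, of "\<lambda>z. \<chi> (\<tau> z)" "inv_into S \<sigma>"] Q by simp
    then show ?thesis
    proof (rule extends_over_cong)
      fix z assume z: "z \<in> R"
      have "\<tau>' (\<tau> z) = z" using z \<tau>(2) Hom_inj[OF R \<tau>(1)] by (auto simp: \<tau>'_def)
      then have "\<chi> (\<tau> z) = \<sigma> (\<phi> z)" using z \<tau>(2) by (auto simp: \<chi>_def compose_def)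
      then show "inv_into S \<sigma> (\<chi> (\<tau> z)) = \<phi> z" using Hom_inj[OF S \<sigma>(1)] z by (simp add: S_def)
    qed
  qed
qed

end

section \<open>Products of normal subgroups and O_p(F)\<close>

lemma normal_in_fusion_I:
  assumes W: "subgroup W P" "normalizer_in P W = carrier P"
    and ext: "\<And>R \<phi>. subgroup R P \<Longrightarrow> \<phi> \<in> Hom R (carrier P) \<Longrightarrow> extends_over W R \<phi>"
  shows "normal_in_fusion P Hom W"
proof -
  have nW: "W \<lhd> P" by (rule normal_of_normalizer_in[OF W])
  have "\<exists>\<psi> \<in> Hom (W <#> R1) (W <#> R2). (\<forall>z \<in> R1. \<psi> z = \<phi> z) \<and> \<psi> ` W = W"
    if R: "subgroup R1 P" "subgroup R2 P" and \<phi>: "\<phi> \<in> Hom R1 R2" for R1 R2 \<phi>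
  proof -
    have \<phi>': "\<phi> \<in> Hom R1 (carrier P)" "\<phi> ` R1 \<subseteq> R2" using \<phi> Hom_iff[OF R] by auto
    obtain \<psi> where \<psi>: "\<psi> \<in> Hom (W <#> R1) (carrier P)" "\<forall>z \<in> R1. \<psi> z = \<phi> z" "\<psi> ` W = W"
      using ext[OF R(1) \<phi>'(1)] by (auto simp: extends_over_def)
    have "\<psi> ` R1 \<subseteq> R2" using \<psi>(2) \<phi>'(2) by auto
    then have "\<psi> ` (W <#> R1) \<subseteq> W <#> R2"
      using Hom_image_prod[OF nW R(1) \<psi>(1)] \<psi>(3) by (auto simp: set_mult_def)
    then have "\<psi> \<in> Hom (W <#> R1) (W <#> R2)"
      using Hom_iff[OF prod_subgroup[OF nW R(1)] prod_subgroup[OF nW R(2)]] \<psi>(1) by blast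
    then show ?thesis using \<psi> by blast
  qed
  then show ?thesis using W unfolding normal_in_fusion_def by blast
qed

lemma normal_in_fusion_extends:
  assumes W: "normal_in_fusion P Hom W" and R: "subgroup R P" and \<phi>: "\<phi> \<in> Hom R (carrier P)"
  shows "extends_over W R \<phi>"
proof -
  have W': "subgroup W P" "normalizer_in P W = carrier P" using W by (auto simp: normal_in_fusion_def)
  have nW: "W \<lhd> P" by (rule normal_of_normalizer_in[OF W'])
  obtain \<psi> where \<psi>: "\<psi> \<in> Hom (W <#> R) (W <#> carrier P)" "\<forall>z \<in> R. \<psi> z = \<phi> z" "\<psi> ` W = W"
    using W R \<phi> subgroup_self unfolding normal_in_fusion_def by blast
  then have "\<psi> \<in> Hom (W <#> R) (carrier P)"
    using Hom_iff[OF prod_subgroup[OF nW R] prod_subgroup[OF nW subgroup_self]] by blast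
  then show ?thesis using \<psi> unfolding extends_over_def by blast
qed

text \<open>Extend first from R to N R, then from N R to M (N R) = (M N) R. The second extension
  agrees with the first on \<open>N\<close>, so it preserves both factors.\<close>

lemma normal_in_fusion_prod:
  assumes M: "normal_in_fusion P Hom M" and N: "normal_in_fusion P Hom N"
  shows "normal_in_fusion P Hom (M <#> N)"
proof -
  have M': "subgroup M P" "normalizer_in P M = carrier P" using M by (auto simp: normal_in_fusion_def)
  have N': "subgroup N P" "normalizer_in P N = carrier P" using N by (auto simp: normal_in_fusion_def)
  have nM: "M \<lhd> P" and nN: "N \<lhd> P"
    using normal_of_normalizer_in[OF M'] normal_of_normalizer_in[OF N'] by auto
  have MG: "M \<subseteq> carrier P" and NG: "N \<subseteq> carrier P" using subgroup.subset[OF M'(1)] subgroup.subset[OF N'(1)] .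
  have MN: "subgroup (M <#> N) P" by (rule prod_subgroup[OF nM N'(1)])
  show ?thesis
  proof (rule normal_in_fusion_I[OF MN])
    have "x \<otimes> z \<otimes> inv x \<in> M <#> N" if x: "x \<in> carrier P" and z: "z \<in> M <#> N" for x z
    proof -
      obtain a b where ab: "a \<in> M" "b \<in> N" "z = a \<otimes> b" using z by (auto simp: set_mult_def)
      have "x \<otimes> z \<otimes> inv x = (x \<otimes> a \<otimes> inv x) \<otimes> (x \<otimes> b \<otimes> inv x)"
        using ab x MG NG by (auto simp: m_assoc inv_mult_cancel_left subset_iff)
      moreover have "x \<otimes> a \<otimes> inv x \<in> M" "x \<otimes> b \<otimes> inv x \<in> N"
        using nM nN ab x by (auto simp: normal_inv_iff)
      ultimately show ?thesis by (auto simp: set_mult_def)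
    qed
    then show "normalizer_in P (M <#> N) = carrier P"
      using normalizer_in_alt[OF subgroup.subset[OF MN] finite_P] by auto
  next
    fix R \<phi> assume R: "subgroup R P" and \<phi>: "\<phi> \<in> Hom R (carrier P)"
    have RG: "R \<subseteq> carrier P" using R by (rule subgroup.subset)
    have NR: "subgroup (N <#> R) P" by (rule prod_subgroup[OF nN R])
    obtain \<psi> where \<psi>: "\<psi> \<in> Hom (N <#> R) (carrier P)" "\<forall>z \<in> R. \<psi> z = \<phi> z" "\<psi> ` N = N"
      using normal_in_fusion_extends[OF N R \<phi>] by (auto simp: extends_over_def)
    obtain \<xi> where \<xi>: "\<xi> \<in> Hom (M <#> (N <#> R)) (carrier P)" "\<forall>z \<in> N <#> R. \<xi> z = \<psi> z" "\<xi> ` M = M"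
      using normal_in_fusion_extends[OF M NR \<psi>(1)] by (auto simp: extends_over_def)
    have assoc: "M <#> (N <#> R) = (M <#> N) <#> R"
      using set_mult_assoc[OF MG NG RG] by simp
    have "\<xi> ` N = \<psi> ` N" using subset_prod(2)[OF nN R] \<xi>(2) by (intro image_cong) auto
    then have \<xi>N: "\<xi> ` N = N" using \<psi>(3) by simp
    have "restrict \<xi> (M <#> N) \<in> Hom (M <#> N) (carrier P)"
    proof (rule Hom_restrict[OF prod_subgroup[OF nM NR] \<xi>(1) MN])
      show "M <#> N \<subseteq> M <#> (N <#> R)" by (rule mono_set_mult[OF subset_refl subset_prod(2)[OF nN R]])
    qed
    from Hom_image_prod[OF nM N'(1) this]
    have "\<xi> ` (M <#> N) = \<xi> ` M <#> \<xi> ` N"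
      by (simp only: restrict_image_subset[OF subset_refl] restrict_image_subset[OF subset_prod(1)[OF nM N'(1)]]
        restrict_image_subset[OF subset_prod(2)[OF nM N'(1)]])
    then have "\<xi> ` (M <#> N) = M <#> N" using \<xi>(3) \<xi>N by simp
    moreover have "\<forall>z \<in> R. \<xi> z = \<phi> z" using \<xi>(2) \<psi>(2) subset_prod(1)[OF nN R] by auto
    ultimately show "extends_over (M <#> N) R \<phi>"
      using \<xi>(1) unfolding assoc extends_over_def by blast
  qed
qed

text \<open>\<open>GREATEST\<close> is meaningful only once a largest member is exhibited. A normal
  subgroup \<open>M\<close> of maximal order is one: its product with any other \<open>N\<close> is
  normal and contains \<open>M\<close>, so it equals \<open>M\<close>.\<close>

lemma normal_in_fusion_subset_O_p:
  assumes W: "normal_in_fusion P Hom W"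
  shows "W \<subseteq> O_p_fusion P Hom"
proof -
  have "card M < Suc (card (carrier P))" if "normal_in_fusion P Hom M" for M
    unfolding less_Suc_eq_le
    using that subgroup.subset by (intro card_mono[OF finite_P]) (auto simp: normal_in_fusion_def)
  then obtain M where M: "normal_in_fusion P Hom M"
    and max: "\<And>N. normal_in_fusion P Hom N \<Longrightarrow> card N \<le> card M"
    using ex_has_greatest_nat[of "normal_in_fusion P Hom" W card "Suc (card (carrier P))"] W by blast
  have sub: "N \<subseteq> M" if N: "normal_in_fusion P Hom N" for N
  proof -
    have M': "subgroup M P" "M \<lhd> P" and N': "subgroup N P"
      using M N normal_of_normalizer_in by (auto simp: normal_in_fusion_def)
    have "card (M <#> N) \<le> card M" by (rule max[OF normal_in_fusion_prod[OF M N]])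
    then have "M = M <#> N"
      using subset_prod[OF M'(2) N'] finite_subgroup[OF prod_subgroup[OF M'(2) N']]
      by (intro card_seteq) auto
    then show ?thesis using subset_prod(1)[OF M'(2) N'] by simp
  qed
  have "O_p_fusion P Hom = M"
    unfolding O_p_fusion_def by (rule Greatest_equality) (use M sub in auto)
  then show ?thesis using sub[OF W] by simp
qed

end

section \<open>The exponent of the center\<close>

text \<open>Here \<open>V\<close> is Z(Q) and \<open>D w\<close> is the commutator of
  \<open>x\<close> with \<open>w\<close>. The conclusion says that \<open>D\<close> kills the q-th
  power of \<open>v\<close>, for q = p^n, which is \<open>D v [^] (p ^ n) = \<one>\<close> because
  \<open>D\<close> is a homomorphism on \<open>V\<close>.\<close>

lemma (in group) commutator_prime_power_eq_one:
  assumes p: "Factorial_Ring.prime (p::nat)" and cls: "nilpotent_class_le G (n * (p - 1) + 1)"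
    and Q: "subgroup Q G" and x: "x \<in> normalizer_in G Q" and xp: "x [^] p \<in> Q"
    and v: "v \<in> Q" "\<forall>z \<in> Q. v \<otimes> z = z \<otimes> v"
  shows "x \<otimes> v [^] (p ^ n) \<otimes> inv x = v [^] (p ^ n)"
proof -
  define V where "V = {v \<in> Q. \<forall>z \<in> Q. v \<otimes> z = z \<otimes> v}"
  define c where "c = (\<lambda>w. x \<otimes> w \<otimes> inv x)"
  define D where "D = (\<lambda>w. c w \<otimes> inv w)"
  have QG: "w \<in> carrier G" if "w \<in> Q" for w using that subgroup.subset[OF Q] by blast
  have xG: "x \<in> carrier G" using x by (simp add: normalizer_in_def)
  have VG: "w \<in> carrier G" if "w \<in> V" for w using that QG by (simp add: V_def)
  have comm: "w \<otimes> z = z \<otimes> w" if "w \<in> V" "z \<in> Q" for w z using that unfolding V_def by blast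
  have V: "subgroup V G"
  proof -
    interpret Q: group "G\<lparr>carrier := Q\<rparr>" using Q by (rule subgroup_imp_group)
    have "V = grp_center (G\<lparr>carrier := Q\<rparr>)" by (simp add: V_def grp_center_def)
    then show ?thesis using Q.grp_center_subgroup incl_subgroup[OF Q] by simp
  qed
  have Vcomm: "comm_group (G\<lparr>carrier := V\<rparr>)"
  proof (rule group.group_comm_groupI[OF subgroup_imp_group[OF V]])
    fix a b assume "a \<in> carrier (G\<lparr>carrier := V\<rparr>)" "b \<in> carrier (G\<lparr>carrier := V\<rparr>)"
    then have "a \<in> V" "b \<in> Q" by (auto simp: V_def)
    then show "a \<otimes>\<^bsub>G\<lparr>carrier := V\<rparr>\<^esub> b = b \<otimes>\<^bsub>G\<lparr>carrier := V\<rparr>\<^esub> a" using comm by simp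
  qed
  have c_mult: "c (a \<otimes> b) = c a \<otimes> c b" if "a \<in> carrier G" "b \<in> carrier G" for a b
    using that xG by (simp add: c_def m_assoc inv_mult_cancel_left)
  have cG: "c a \<in> carrier G" if "a \<in> carrier G" for a using that xG by (simp add: c_def)
  have cV: "c w \<in> V" if w: "w \<in> V" for w
  proof -
    have "c w \<in> Q" using x w by (auto simp: c_def V_def normalizer_in_def)
    moreover have "c w \<otimes> z = z \<otimes> c w" if "z \<in> Q" for z
    proof -
      have "z \<in> (\<lambda>z. x \<otimes> z \<otimes> inv x) ` Q" using x that by (simp add: normalizer_in_def)
      then obtain z' where z': "z' \<in> Q" "z = c z'" by (auto simp: c_def)
      have "c w \<otimes> c z' = c (w \<otimes> z')" using c_mult VG[OF w] QG[OF z'(1)] by simp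
      also have "w \<otimes> z' = z' \<otimes> w" by (rule comm[OF w z'(1)])
      also have "c (z' \<otimes> w) = c z' \<otimes> c w" using c_mult VG[OF w] QG[OF z'(1)] by simp
      finally show ?thesis using z'(2) by simp
    qed
    ultimately show ?thesis by (simp add: V_def)
  qed
  have DV: "D w \<in> V" if "w \<in> V" for w
    unfolding D_def using subgroup.m_closed[OF V cV subgroup.m_inv_closed[OF V]] that by blast
  have "D \<in> hom (G\<lparr>carrier := V\<rparr>) (G\<lparr>carrier := V\<rparr>)"
  proof -
    have "D (a \<otimes> b) = D a \<otimes> D b" if ab: "a \<in> V" "b \<in> V" for a b
    proof -
      have G: "a \<in> carrier G" "b \<in> carrier G" "c a \<in> carrier G" "c b \<in> carrier G"
        using ab VG cG by auto
      have "inv a \<in> V" "D b \<in> Q" using ab subgroup.m_inv_closed[OF V] DV by (auto simp: V_def)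
      \<comment> \<open>\<open>inv a\<close> is central in \<open>Q\<close>, so it passes
        \<open>D b\<close>; this makes \<open>D\<close> multiplicative on \<open>V\<close>.\<close>
      then have s: "inv a \<otimes> D b = D b \<otimes> inv a" by (rule comm)
      have "D (a \<otimes> b) = c a \<otimes> (D b \<otimes> inv a)"
        using G by (simp add: D_def c_mult inv_mult_group m_assoc)
      also have "\<dots> = c a \<otimes> (inv a \<otimes> D b)" by (simp only: s)
      also have "\<dots> = D a \<otimes> D b" using G by (simp add: D_def m_assoc)
      finally show ?thesis .
    qed
    then show ?thesis using DV by (auto simp: hom_def)
  qed
  then interpret E: abelian_endo "G\<lparr>carrier := V\<rparr>" D
    using Vcomm by (simp add: abelian_endo_def abelian_endo_axioms_def)
  have vV: "v \<in> V" using v by (simp add: V_def)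
  have DkV: "(D ^^ k) v \<in> V" for k by (induction k) (use vV DV in auto)
  \<comment> \<open>\<open>lower_central\<close> has the whole group at index 0, so the bound on the
    class kills precisely the power of \<open>D\<close> in \<open>endo_prime_power_eq_one\<close>.
    The generators of the next term have \<open>w\<close> in the first place, so \<open>D w\<close>
    is the inverse of a generator.\<close>
  have "(D ^^ k) v \<in> lower_central G k" for k
  proof (induction k)
    case 0
    then show ?case using vV VG by simp
  next
    case (Suc k)
    define w where "w = (D ^^ k) v"
    have wV: "w \<in> V" unfolding w_def by (rule DkV)
    have "w \<otimes> x \<otimes> inv w \<otimes> inv x \<in> grp_commutator_set G (lower_central G k) (carrier G)"
      unfolding grp_commutator_set_def using Suc xG w_def by blast
    then have "inv (w \<otimes> x \<otimes> inv w \<otimes> inv x) \<in> lower_central G (Suc k)"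
      by (simp add: generate.inv)
    also have "inv (w \<otimes> x \<otimes> inv w \<otimes> inv x) = D w"
      using VG[OF wV] xG by (simp add: D_def c_def inv_mult_group m_assoc)
    finally show ?case by (simp add: w_def)
  qed
  then have nilp: "(D ^^ (n * (p - 1) + 1)) v = \<one>"
    using cls unfolding nilpotent_class_le_def by blast
  \<comment> \<open>So 1 + D is conjugation by \<open>x\<close> on Z(Q). Its p-th iterate is
    conjugation by \<open>x [^] p\<close>, an element of \<open>Q\<close>, and therefore fixes
    \<open>v\<close>.\<close>
  have Dc: "w \<otimes> D w = c w" if w: "w \<in> V" for w
  proof -
    have "w \<otimes> D w = D w \<otimes> w" using comm[OF w, of "D w"] DV[OF w] by (simp add: V_def)
    then show ?thesis using VG[OF w] cG[OF VG[OF w]] by (simp add: D_def m_assoc)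
  qed
  have "((\<lambda>w. w \<otimes> D w) ^^ k) v = x [^] k \<otimes> v \<otimes> inv (x [^] k) \<and> ((\<lambda>w. w \<otimes> D w) ^^ k) v \<in> V" for k
  proof (induction k)
    case 0
    then show ?case using vV VG by simp
  next
    case (Suc k)
    define w where "w = ((\<lambda>w. w \<otimes> D w) ^^ k) v"
    have w: "w = x [^] k \<otimes> v \<otimes> inv (x [^] k)" "w \<in> V" using Suc by (auto simp: w_def)
    have "x [^] Suc k = x \<otimes> x [^] k" using nat_pow_mult[OF xG, of 1 k] xG by simp
    then have "c w = x [^] Suc k \<otimes> v \<otimes> inv (x [^] Suc k)"
      unfolding w(1) using xG VG[OF vV] by (simp add: c_def m_assoc inv_mult_group del: nat_pow_Suc)
    then show ?case using Dc[OF w(2)] cV[OF w(2)] by (simp add: w_def[symmetric] del: nat_pow_Suc)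
  qed
  then have "((\<lambda>w. w \<otimes> D w) ^^ p) v = x [^] p \<otimes> v \<otimes> inv (x [^] p)" by blast
  also have "\<dots> = v \<otimes> x [^] p \<otimes> inv (x [^] p)" using comm[OF vV xp] by simp
  also have "\<dots> = v" using xG VG[OF vV] by (simp add: m_assoc)
  finally have per: "((\<lambda>w. w \<otimes> D w) ^^ p) v = v" .
  have "D v [^] (p ^ n) = \<one>"
    using E.endo_prime_power_eq_one[OF p, of v n] vV nilp per by (simp add: nat_pow_consistent[symmetric])
  moreover have "D v [^] k = D (v [^] k) \<and> v [^] k \<in> V" for k :: nat
  proof (induction k)
    case 0
    show ?case using E.D_one subgroup.one_closed[OF V] by simp
  next
    case (Suc k)
    then show ?case using E.D_mult[of "v [^] k" v] subgroup.m_closed[OF V] vV by simp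
  qed
  ultimately have "D (v [^] (p ^ n)) = \<one>" "v [^] (p ^ n) \<in> V" by auto
  then show ?thesis using Dc[of "v [^] (p ^ n)"] VG by (simp add: c_def)
qed

section \<open>Normality of the group of q-th powers of the center\<close>

context saturated_fusion
begin

text \<open>The Frattini argument supplies \<open>\<kappa>\<close> in \<open>K\<close> such that
  \<open>\<kappa> \<chi>\<close> conjugates the intersection of Aut_P(Q) with \<open>K\<close> into
  Aut_P(Q). An element x of the normalizer outside \<open>Q\<close> with x^p in \<open>Q\<close>
  induces an element of this intersection, hence lies in \<open>N_phi\<close> of the
  composite.\<close>

lemma centric_correction:
  assumes cls: "nilpotent_class_le P (n * (p - 1) + 1)"
    and Q: "subgroup Q P" and neP: "Q \<noteq> carrier P" and fn: "fully_normalized P Hom Q"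
    and centric: "{c \<in> carrier P. \<forall>z \<in> Q. c \<otimes> z = z \<otimes> c} \<subseteq> Q" and \<chi>: "\<chi> \<in> Hom Q Q"
  shows "\<exists>\<kappa> \<in> Hom Q Q. (\<forall>z \<in> grp_center P. \<kappa> (z [^] (p ^ n)) = z [^] (p ^ n)) \<and>
    N_phi P Q (compose Q \<kappa> \<chi>) \<noteq> Q"
proof -
  define V where "V = {v \<in> Q. \<forall>z \<in> Q. v \<otimes> z = z \<otimes> v}"
  define q where "q = p ^ n"
  define K where "K = {\<kappa> \<in> Hom Q Q. \<forall>v \<in> V. \<kappa> (v [^] q) = v [^] q}"
  interpret A: group "AutF Q" by (rule group_AutF[OF Q])
  have QG: "w \<in> carrier P" if "w \<in> Q" for w using that subgroup.subset[OF Q] by blast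
  have VQ: "V \<subseteq> Q" by (auto simp: V_def)
  have powQ: "v [^] (k::nat) \<in> Q" if "v \<in> Q" for v k
    using that by (induction k) (auto simp: subgroup.one_closed[OF Q] subgroup.m_closed[OF Q])
  \<comment> \<open>Invariance of Z(Q) under Aut_F(Q) is what makes \<open>K\<close> normal
    there.\<close>
  have fV: "f ` V = V" if f: "f \<in> Hom Q Q" for f
  proof (rule endo_inj_surj)
    have f': "f \<in> Hom Q (carrier P)" "f ` Q = Q" using f by (auto simp: Aut_iff[OF Q])
    show "finite V" using VQ finite_subgroup[OF Q] finite_subset by blast
    show "inj_on f V" using Hom_inj[OF Q f'(1)] VQ inj_on_subset by blast
    show "f ` V \<subseteq> V"
    proof
      fix u assume "u \<in> f ` V"
      then obtain v where v: "v \<in> V" "u = f v" by blast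
      have vQ: "v \<in> Q" using v(1) VQ by blast
      have "u \<otimes> z = z \<otimes> u" if "z \<in> Q" for z
      proof -
        have "z \<in> f ` Q" using that f'(2) by simp
        then obtain w where w: "w \<in> Q" "z = f w" by blast
        have "f v \<otimes> f w = f (v \<otimes> w)" using Hom_mult[OF Q f'(1) vQ w(1)] by simp
        also have "v \<otimes> w = w \<otimes> v" using v(1) w(1) unfolding V_def by blast
        also have "f (w \<otimes> v) = f w \<otimes> f v" by (rule Hom_mult[OF Q f'(1) w(1) vQ])
        finally show ?thesis using v(2) w(2) by simp
      qed
      moreover have "u \<in> Q" using v(2) Aut_closed[OF Q f vQ] by simp
      ultimately show "u \<in> V" unfolding V_def by blast
    qed
  qed
  have K: "K \<lhd> AutF Q"
  proof -
    have "subgroup K (AutF Q)"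
    proof (rule A.subgroupI)
      show "K \<subseteq> carrier (AutF Q)" by (auto simp: K_def carrier_AutF)
      have "\<one>\<^bsub>AutF Q\<^esub> \<in> K"
        using A.one_closed powQ VQ unfolding K_def by (auto simp: carrier_AutF AutF_one)
      then show "K \<noteq> {}" by blast
    next
      fix f assume "f \<in> K"
      then have f: "f \<in> Hom Q Q" "\<And>v. v \<in> V \<Longrightarrow> f (v [^] q) = v [^] q" by (auto simp: K_def)
      define g where "g = inv\<^bsub>AutF Q\<^esub> f"
      have g: "g \<in> Hom Q Q" using A.inv_closed f(1) by (simp add: g_def carrier_AutF)
      have "g \<otimes>\<^bsub>AutF Q\<^esub> f = \<one>\<^bsub>AutF Q\<^esub>" using A.l_inv f(1) by (simp add: g_def carrier_AutF)
      then have gf: "compose Q g f = (\<lambda>z\<in>Q. z)" by (simp add: AutF_mult[OF Q g f(1)] AutF_one)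
      have "g (v [^] q) = v [^] q" if v: "v \<in> V" for v
      proof -
        have vq: "v [^] q \<in> Q" using powQ v VQ by blast
        have "g (f (v [^] q)) = v [^] q" using fun_cong[OF gf, of "v [^] q"] vq by (simp add: compose_def)
        then show ?thesis using f(2)[OF v] by simp
      qed
      then show "inv\<^bsub>AutF Q\<^esub> f \<in> K" using g by (simp add: K_def g_def)
    next
      fix f g assume f: "f \<in> K" and g: "g \<in> K"
      then have fg: "f \<in> Hom Q Q" "g \<in> Hom Q Q" by (auto simp: K_def)
      have "f \<otimes>\<^bsub>AutF Q\<^esub> g \<in> Hom Q Q" using A.m_closed fg by (simp add: carrier_AutF)
      moreover have "(f \<otimes>\<^bsub>AutF Q\<^esub> g) (v [^] q) = v [^] q" if v: "v \<in> V" for v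
      proof -
        have "v [^] q \<in> Q" using powQ v VQ by blast
        then show ?thesis using f g v by (simp add: AutF_mult[OF Q fg] compose_def K_def)
      qed
      ultimately show "f \<otimes>\<^bsub>AutF Q\<^esub> g \<in> K" by (simp add: K_def)
    qed
    moreover have "f \<otimes>\<^bsub>AutF Q\<^esub> k \<otimes>\<^bsub>AutF Q\<^esub> inv\<^bsub>AutF Q\<^esub> f \<in> K" if f: "f \<in> Hom Q Q" and k: "k \<in> K" for f k
    proof -
      define h where "h = f \<otimes>\<^bsub>AutF Q\<^esub> k \<otimes>\<^bsub>AutF Q\<^esub> inv\<^bsub>AutF Q\<^esub> f"
      have kQ: "k \<in> Hom Q Q" using k by (simp add: K_def)
      have h: "h \<in> Hom Q Q" unfolding h_def using f kQ A.m_closed A.inv_closed by (simp add: carrier_AutF)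
      have fk: "\<forall>z \<in> Q. f (k z) = h (f z)" using AutF_conj_iff[OF Q f kQ h] h_def by blast
      have f': "f \<in> Hom Q (carrier P)" using f by (simp add: Aut_iff[OF Q])
      have "h (v [^] q) = v [^] q" if "v \<in> V" for v
      proof -
        obtain w where w: "w \<in> V" "v = f w" using fV[OF f] \<open>v \<in> V\<close> by blast
        have wQ: "w \<in> Q" using w VQ by blast
        have vq: "v [^] q = f (w [^] q)" using Hom_pow[OF Q f' wQ] w(2) by simp
        have "h (f (w [^] q)) = f (k (w [^] q))" using fk powQ[OF wQ] by simp
        also have "k (w [^] q) = w [^] q" using k w(1) by (simp add: K_def)
        finally show ?thesis by (simp only: vq)
      qed
      then show ?thesis using h by (simp add: K_def h_def)
    qed
    ultimately show ?thesis by (simp add: A.normal_inv_iff carrier_AutF)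
  qed
  obtain x where x: "x \<in> normalizer_in P Q" "x \<notin> Q" "x [^] p \<in> Q"
    using normalizer_ne[OF Q neP] by blast
  define t where "t = conjmap P x Q"
  have tQ: "t \<in> Hom Q Q" unfolding t_def by (rule conjmap_Aut[OF Q x(1)])
  have "t \<in> K"
  proof -
    have "t (v [^] q) = v [^] q" if v: "v \<in> V" for v
      using commutator_prime_power_eq_one[OF prime_p cls Q x(1,3), of v] v powQ
      by (simp add: t_def conjmap_def V_def q_def)
    then show ?thesis using tQ by (simp add: K_def)
  qed
  moreover have "t \<in> AutP Q" using x(1) by (simp add: t_def AutP_def)
  moreover obtain k where k: "card (AutP Q) = p ^ k" using card_AutP_p_power[OF Q] by blast
  obtain m where m: "card (carrier (AutF Q)) = card (AutP Q) * m" "\<not> p dvd m"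
    using fully_normalized_sylow[OF fn] by (auto simp: carrier_AutF)
  have "\<chi> \<in> carrier (AutF Q)" using \<chi> by (simp add: carrier_AutF)
  from A.sylow_frattini[OF prime_p finite_AutF[OF Q] AutP_subgroup[OF Q] k m K this]
  obtain \<kappa> where \<kappa>: "\<kappa> \<in> K" and
    \<kappa>t: "\<forall>t \<in> AutP Q \<inter> K. (\<kappa> \<otimes>\<^bsub>AutF Q\<^esub> \<chi>) \<otimes>\<^bsub>AutF Q\<^esub> t \<otimes>\<^bsub>AutF Q\<^esub> inv\<^bsub>AutF Q\<^esub> (\<kappa> \<otimes>\<^bsub>AutF Q\<^esub> \<chi>) \<in> AutP Q"
    by blast
  have \<kappa>Q: "\<kappa> \<in> Hom Q Q" using \<kappa> by (simp add: K_def)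
  define \<theta> where "\<theta> = \<kappa> \<otimes>\<^bsub>AutF Q\<^esub> \<chi>"
  have \<theta>: "\<theta> \<in> Hom Q Q" unfolding \<theta>_def using \<kappa>Q \<chi> A.m_closed by (simp add: carrier_AutF)
  have \<theta>_eq: "\<theta> = compose Q \<kappa> \<chi>" unfolding \<theta>_def by (rule AutF_mult[OF Q \<kappa>Q \<chi>])
  define h where "h = \<theta> \<otimes>\<^bsub>AutF Q\<^esub> t \<otimes>\<^bsub>AutF Q\<^esub> inv\<^bsub>AutF Q\<^esub> \<theta>"
  \<comment> \<open>\<open>calculation\<close> still holds the two memberships of \<open>t\<close>,
    in \<open>K\<close> and in \<open>AutP Q\<close>.\<close>
  have h: "h \<in> AutP Q" unfolding h_def \<theta>_def using \<kappa>t calculation by blast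
  then have hQ: "h \<in> Hom Q Q" using subgroup.subset[OF AutP_subgroup[OF Q]] by (auto simp: carrier_AutF)
  obtain y where y: "y \<in> normalizer_in P Q" "\<forall>z \<in> Q. h z = y \<otimes> z \<otimes> inv y"
    using h mem_AutP_iff[OF Q hQ] by blast
  have "\<forall>z \<in> Q. \<theta> (t z) = h (\<theta> z)" using AutF_conj_iff[OF Q \<theta> tQ hQ] h_def by blast
  then have "\<forall>z \<in> Q. \<theta> (x \<otimes> z \<otimes> inv x) = y \<otimes> \<theta> z \<otimes> inv y"
    using y(2) Aut_closed[OF Q \<theta>] by (simp add: t_def conjmap_def)
  then have "x \<in> N_phi P Q \<theta>" using x(1) y(1) Aut_image[OF Q \<theta>] unfolding N_phi_def by auto
  then have "N_phi P Q (compose Q \<kappa> \<chi>) \<noteq> Q" using x(2) by (auto simp: \<theta>_eq)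
  moreover have "\<kappa> (z [^] q) = z [^] q" if z: "z \<in> grp_center P" for z
  proof -
    \<comment> \<open>Centricity enters here: it puts the center of \<open>P\<close> inside Z(Q),
      where \<open>K\<close> fixes the q-th powers.\<close>
    have "z \<in> carrier P" "\<forall>w \<in> Q. z \<otimes> w = w \<otimes> z" using z QG unfolding grp_center_def by auto
    then have "z \<in> V" using centric unfolding V_def by blast
    then show ?thesis using \<kappa> by (simp add: K_def)
  qed
  ultimately show ?thesis using \<kappa>Q by (auto simp: q_def)
qed

text \<open>The q-th powers form a subgroup because the center is abelian. Automorphisms of
  \<open>P\<close> preserve the center and commute with powers, which settles the top of the
  induction in \<open>extends_over_all\<close>; \<open>centric_correction\<close> settles the
  rest.\<close>

lemma center_power_normal:
  assumes cls: "nilpotent_class_le P (n * (p - 1) + 1)"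
  shows "normal_in_fusion P Hom ((\<lambda>z. z [^] (p ^ n)) ` grp_center P)"
proof -
  define q where "q = p ^ n"
  define Z where "Z = grp_center P"
  define W where "W = (\<lambda>z. z [^] q) ` Z"
  have Z: "subgroup Z P" unfolding Z_def by (rule grp_center_subgroup)
  have ZG: "z \<in> carrier P" if "z \<in> Z" for z using that subgroup.subset[OF Z] by blast
  have comm: "z \<otimes> x = x \<otimes> z" if "z \<in> Z" "x \<in> carrier P" for z x
    using that unfolding Z_def grp_center_def by blast
  have powZ: "z [^] (k::nat) \<in> Z" if "z \<in> Z" for z k
    using that by (induction k) (auto simp: subgroup.one_closed[OF Z] subgroup.m_closed[OF Z])
  then have WZ: "W \<subseteq> Z" by (auto simp: W_def)
  have W: "subgroup W P"
  proof (rule subgroupI)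
    show "W \<subseteq> carrier P" using WZ ZG by blast
    show "W \<noteq> {}" using subgroup.one_closed[OF Z] by (auto simp: W_def)
  next
    fix a assume "a \<in> W"
    then obtain z where z: "z \<in> Z" "a = z [^] q" by (auto simp: W_def)
    then have "inv a = (inv z) [^] q" using ZG by (simp add: nat_pow_inv)
    then show "inv a \<in> W" using subgroup.m_inv_closed[OF Z z(1)] by (auto simp: W_def)
  next
    fix a b assume "a \<in> W" "b \<in> W"
    then obtain y z where z: "y \<in> Z" "a = y [^] q" "z \<in> Z" "b = z [^] q" by (auto simp: W_def)
    then have "a \<otimes> b = (y \<otimes> z) [^] q" using ZG comm by (simp add: pow_mult_distrib)
    then show "a \<otimes> b \<in> W" using subgroup.m_closed[OF Z z(1,3)] by (auto simp: W_def)
  qed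
  have conj: "x \<otimes> w \<otimes> inv x = w" if "w \<in> W" "x \<in> carrier P" for w x
  proof -
    have w: "w \<in> Z" using that(1) WZ by blast
    have "x \<otimes> w \<otimes> inv x = w \<otimes> x \<otimes> inv x" by (simp only: comm[OF w that(2)])
    then show ?thesis using ZG[OF w] that(2) by (simp add: m_assoc)
  qed
  have NW: "normalizer_in P W = carrier P"
    using normalizer_in_alt[OF subgroup.subset[OF W] finite_P] conj by auto
  have "normal_in_fusion P Hom W"
  proof (rule normal_in_fusion_I[OF W NW])
    fix R \<phi> assume R: "subgroup R P" and \<phi>: "\<phi> \<in> Hom R (carrier P)"
    show "extends_over W R \<phi>"
    proof (rule extends_over_all[OF normal_of_normalizer_in[OF W NW] _ _ _ R \<phi>])
      show "W \<subseteq> grp_center P" using WZ by (simp add: Z_def)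
    next
      fix f assume f: "f \<in> Hom (carrier P) (carrier P)"
      have im: "f ` carrier P = carrier P" by (rule Aut_image[OF subgroup_self f])
      have fZ: "f ` Z = Z"
      proof (rule endo_inj_surj)
        show "finite Z" by (rule finite_subgroup[OF Z])
        show "inj_on f Z" using Hom_inj[OF subgroup_self f] ZG by (meson inj_on_subset subsetI)
        show "f ` Z \<subseteq> Z"
        proof
          fix u assume "u \<in> f ` Z"
          then obtain z where z: "z \<in> Z" "u = f z" by blast
          have "u \<otimes> y = y \<otimes> u" if "y \<in> carrier P" for y
          proof -
            have "y \<in> f ` carrier P" using that im by simp
            then obtain x where x: "x \<in> carrier P" "y = f x" by blast
            have "f z \<otimes> f x = f (z \<otimes> x)" using Hom_mult[OF subgroup_self f] ZG[OF z(1)] x(1) by simp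
            also have "z \<otimes> x = x \<otimes> z" by (rule comm[OF z(1) x(1)])
            also have "f (x \<otimes> z) = f x \<otimes> f z" using Hom_mult[OF subgroup_self f] ZG[OF z(1)] x(1) by simp
            finally show ?thesis using z(2) x(2) by simp
          qed
          then show "u \<in> Z"
            using Hom_closed[OF subgroup_self f ZG[OF z(1)]] z(2) unfolding Z_def grp_center_def by blast
        qed
      qed
      have "f ` W = (\<lambda>z. z [^] q) ` f ` Z"
        unfolding W_def image_image using Hom_pow[OF subgroup_self f] ZG by (intro image_cong) auto
      then show "f ` W = W" by (simp only: fZ W_def)
    next
      fix Q \<chi>
      assume Q: "subgroup Q P" "Q \<noteq> carrier P" "fully_normalized P Hom Q"
        "{c \<in> carrier P. \<forall>z \<in> Q. c \<otimes> z = z \<otimes> c} \<subseteq> Q" "\<chi> \<in> Hom Q Q"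
      obtain \<kappa> where \<kappa>: "\<kappa> \<in> Hom Q Q" "\<forall>z \<in> grp_center P. \<kappa> (z [^] q) = z [^] q"
        "N_phi P Q (compose Q \<kappa> \<chi>) \<noteq> Q"
        using centric_correction[OF cls Q] unfolding q_def by blast
      have "\<kappa> ` W = W" unfolding W_def image_image using \<kappa>(2) by (intro image_cong) (auto simp: Z_def)
      then show "\<exists>\<kappa> \<in> Hom Q Q. \<kappa> ` W = W \<and> N_phi P Q (compose Q \<kappa> \<chi>) \<noteq> Q" using \<kappa> by blast
    qed
  qed
  then show ?thesis by (simp add: W_def Z_def q_def)
qed

end

theorem theorem1p1:
  fixes P (structure) and Hom :: "'a set \<Rightarrow> 'a set \<Rightarrow> ('a \<Rightarrow> 'a) set"
    and p n :: nat
  assumes "Factorial_Ring.prime p"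
    and "group P" and "finite (carrier P)"
    and "\<exists>k. k \<ge> 1 \<and> card (carrier P) = p ^ k"
    and "nilpotent_class_le P (n * (p - 1) + 1)"
    and "saturated_fusion_system P Hom p"
    and "O_p_fusion P Hom = {\<one>}"
  shows "\<forall>z \<in> grp_center P. z [^] (p ^ n) = \<one>"
proof -
  interpret saturated_fusion P Hom p
    using assms by (auto simp: saturated_fusion_def saturated_fusion_axioms_def)
  \<comment> \<open>The group of q-th powers of the center lies in O_p(F), which is trivial.\<close>
  show ?thesis
    using normal_in_fusion_subset_O_p[OF center_power_normal[OF assms(5)]] assms(7) by auto
qed

end
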